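(* Let $E_n$ be the expected number of steps taken by the random edge rule on the $n$-dimensional Klee-Minty cube, started from a uniformly random vertex, until the minimum is reached. Then for all sufficiently large $n$, $$0.086\, n^2 \le E_n \le 0.152\, n^2 .$$
   Context: The random edge rule on the Klee-Minty cube is described by the following combinatorial model: vertices of the cube are identified bijectively with sequences in $\{0,1\}^n$, the minimum being the all-zero sequence. From a nonzero sequence $\mathbf x=(x_1,\dots,x_n)$, one step consists of choosing uniformly at random a position $s$ with $x_s=1$ and flipping ($0\leftrightarrow 1$) the bit at $s$ and simultaneously all bits at positions $s+1,\dots,n$ to its right. Thus $E_n$ is the expected number of steps of this Markov chain until it hits the all-zero sequence, starting from a uniformly distributed element of $\{0,1\}^n$. *)

theory Defs
  imports "HOL-Probability.Probability"
begin

(* Positions are counted from 0, so the admissible positions of x are those s < length x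
   with x ! s. *)
definition km_flip :: "nat \<Rightarrow> bool list \<Rightarrow> bool list" where
  "km_flip s x = take s x @ map Not (drop s x)"

(* The all-zero sequence, which has no admissible position, is absorbing. *)
definition km_step :: "bool list \<Rightarrow> bool list pmf" where
  "km_step x =
     (if \<exists>s<length x. x ! s
      then map_pmf (\<lambda>s. km_flip s x) (pmf_of_set {s. s < length x \<and> x ! s})
      else return_pmf x)"

definition km_init :: "nat \<Rightarrow> bool list pmf" where
  "km_init n = pmf_of_set {x. length x = n}"

(* Law of the state at time i given the trajectory up to time i - 1. *)
definition km_kernel :: "nat \<Rightarrow> nat \<Rightarrow> (nat \<Rightarrow> bool list) \<Rightarrow> bool list measure" where
  "km_kernel n i \<omega> = measure_pmf (if i = 0 then km_init n else km_step (\<omega> (i - 1)))"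

lemma km_kernel_measurable:
  "km_kernel n i \<in> measurable (PiM {0..<i} (\<lambda>_. count_space UNIV)) (subprob_algebra (count_space UNIV))"
proof (cases i)
  case 0
  then show ?thesis
    by (auto simp: km_kernel_def[abs_def] measure_pmf_in_subprob_algebra)
next
  case (Suc j)
  have [measurable]: "(\<lambda>x. measure_pmf (km_step x)) \<in> measurable (count_space UNIV) (subprob_algebra (count_space UNIV))"
    by (simp add: measure_pmf_in_subprob_algebra)
  have [measurable]: "(\<lambda>\<omega>. \<omega> j) \<in> measurable (PiM {0..<Suc j} (\<lambda>_. count_space UNIV)) (count_space UNIV :: bool list measure)"
    by (rule measurable_component_singleton) simp
  show ?thesis
    unfolding Suc km_kernel_def by simp measurable
qed

lemma prob_space_km_kernel: "prob_space (km_kernel n i \<omega>)"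
  unfolding km_kernel_def by (rule prob_space_measure_pmf)

interpretation KM: Ionescu_Tulcea "km_kernel n" "\<lambda>_. count_space UNIV" for n
  by (rule Ionescu_Tulcea.intro) (rule km_kernel_measurable prob_space_km_kernel)+

(* The Ionescu-Tulcea measure of the chain on its trajectories (X_0, X_1, ...). *)
definition km_chain :: "nat \<Rightarrow> (nat \<Rightarrow> bool list) measure" where
  "km_chain n = KM.PF.lim n"

definition km_steps :: "nat \<Rightarrow> (nat \<Rightarrow> bool list) \<Rightarrow> enat" where
  "km_steps n \<omega> = (INF t\<in>{t. \<omega> t = replicate n False}. enat t)"

definition km_expected_steps :: "nat \<Rightarrow> ennreal" where
  "km_expected_steps n = (\<integral>\<^sup>+\<omega>. ennreal_of_enat (km_steps n \<omega>) \<partial>km_chain n)"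

lemma sets_km_chain [measurable_cong]:
  "sets (km_chain n) = sets (PiM UNIV (\<lambda>_. count_space UNIV))"
  by (simp add: km_chain_def)

lemma measurable_km_steps [measurable]: "km_steps n \<in> measurable (km_chain n) (count_space UNIV)"
proof -
  have [measurable]: "(\<lambda>\<omega>. \<omega> t) \<in> measurable (km_chain n) (count_space UNIV :: bool list measure)" for t
    using measurable_component_singleton[of t UNIV "\<lambda>_. count_space UNIV"]
    by (simp add: measurable_cong_sets[OF sets_km_chain refl])
  have "km_steps n = (\<lambda>\<omega>. INF t. if \<omega> t = replicate n False then enat t else \<infinity>)"
  proof (rule ext, rule antisym)
    fix \<omega>
    show "km_steps n \<omega> \<le> (INF t. if \<omega> t = replicate n False then enat t else \<infinity>)"
      unfolding km_steps_def by (rule INF_greatest) (auto intro: INF_lower)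
    show "(INF t. if \<omega> t = replicate n False then enat t else \<infinity>) \<le> km_steps n \<omega>"
      unfolding km_steps_def
    proof (rule INF_greatest)
      fix i assume "i \<in> {t. \<omega> t = replicate n False}"
      then show "(INF t. if \<omega> t = replicate n False then enat t else \<infinity>) \<le> enat i"
        by (intro INF_lower2[of i]) auto
    qed
  qed
  moreover have "(\<lambda>\<omega>. INF t. if \<omega> t = replicate n False then enat t else \<infinity>) \<in>
      measurable (km_chain n) (count_space UNIV)"
    by measurable
  ultimately show ?thesis
    by argo
qed

lemma emeasure_km_chain_cylinder:
  "emeasure (km_chain n) {\<omega>. \<forall>i\<le>k. \<omega> i = x i} =
     ennreal (pmf (km_init n) (x 0) * (\<Prod>i<k. pmf (km_step (x i)) (x (Suc i))))"
proof -
  let ?M = "\<lambda>_::nat. count_space UNIV :: bool list measure"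
  let ?S = "\<lambda>k. PiE {0..<k} (\<lambda>i. {x i})"
  let ?u = "\<lambda>_::nat. undefined :: bool list"
  have S[measurable]: "?S k \<in> sets (PiM {0..<k} ?M)" for k
    by (rule sets_PiM_I_finite) auto
  have u: "?u \<in> space (PiM {0..<0} ?M)"
    by (simp add: space_PiM)
  have eP: "emeasure (KM.eP n k \<omega>) (?S (Suc k)) = emeasure (km_kernel n k x) {x k} * indicator (?S k) \<omega>"
    if "\<omega> \<in> space (PiM {0..<k} ?M)" for k \<omega>
  proof -
    have "fun_upd \<omega> k -` ?S (Suc k) = (if \<omega> \<in> ?S k then {x k} else {})"
      using that by (auto simp: PiE_iff space_PiM extensional_def less_Suc_eq split: if_splits)
    moreover have "km_kernel n k \<omega> = km_kernel n k x" if "\<omega> \<in> ?S k"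
      using that by (auto simp: km_kernel_def PiE_iff)
    ultimately show ?thesis
      using that by (subst KM.emeasure_eP) (auto split: split_indicator)
  qed
  have C: "emeasure (KM.C n 0 k ?u) (?S k) = (\<Prod>i<k. emeasure (km_kernel n i x) {x i})" for k
  proof (induction k)
    case 0
    then show ?case
      by (simp add: PiM_empty)
  next
    case (Suc k)
    have "emeasure (KM.C n 0 (Suc k) ?u) (?S (Suc k)) =
        (\<integral>\<^sup>+\<omega>. emeasure (KM.eP n k \<omega>) (?S (Suc k)) \<partial>KM.C n 0 k ?u)"
      using KM.measurable_eP[of n k]
      by (simp, subst emeasure_bind[where N = "PiM {0..<Suc k} ?M"])
        (auto simp: KM.space_C[OF u] space_PiM_empty_iff measurable_cong_sets[OF KM.sets_C[OF u]])
    also have "\<dots> = (\<integral>\<^sup>+\<omega>. emeasure (km_kernel n k x) {x k} * indicator (?S k) \<omega> \<partial>KM.C n 0 k ?u)"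
      by (intro nn_integral_cong eP) (simp add: KM.space_C[OF u])
    also have "\<dots> = emeasure (km_kernel n k x) {x k} * emeasure (KM.C n 0 k ?u) (?S k)"
      using S[of k] by (intro nn_integral_cmult_indicator) (simp add: KM.sets_C[OF u])
    finally show ?case
      by (simp add: Suc.IH mult.commute)
  qed
  have "{\<omega>. \<forall>i\<le>k. \<omega> i = x i} = prod_emb UNIV ?M {0..<Suc k} (?S (Suc k))"
    by (auto simp: prod_emb_def space_PiM PiE_iff less_Suc_eq_le)
  then have "emeasure (km_chain n) {\<omega>. \<forall>i\<le>k. \<omega> i = x i} = emeasure (KM.CI n {0..<Suc k}) (?S (Suc k))"
    by (simp add: km_chain_def KM.lim)
  also have "\<dots> = emeasure (KM.C n 0 (Suc k) ?u) (?S (Suc k))"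
    using S[of "Suc k"] KM.emeasure_CI[of "{0..<Suc k}" "Suc k" "?S (Suc k)" n]
    by (simp add: prod_emb_id PiE_iff subset_iff)
  also have "\<dots> = ennreal (pmf (km_init n) (x 0) * (\<Prod>i<k. pmf (km_step (x i)) (x (Suc i))))"
    unfolding C prod.lessThan_Suc_shift
    by (simp add: km_kernel_def emeasure_pmf_single ennreal_mult prod_ennreal prod_nonneg)
  finally show ?thesis .
qed

end

theory Submission
  imports Defs "HOL-Real_Asymp.Real_Asymp"
begin

text \<open>
  Run the chain in continuous time: every position that carries a one rings at rate 1, and a ring
  flips that position and everything to its right. The jump chain is the random edge rule, and the
  generator is km_gen. The number of steps and the time are related through the number of ones,
  since x is left at rate card (ones x).

  The proof rests on a self-duality of this process. Let duality x z be the product of the signs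
  -1 over all positions r at which x changes its value (the bit before the first counts as 0) and
  at which z, read backwards, has a one. Flipping x at s changes the first condition at s only;
  flipping z at the position mirrored to s changes the second condition at all r up to s, and the
  signs of the changes of x up to s multiply to the sign of x ! s. So applying the generator in x
  or in z gives the same function, namely duality x z times -2 times the number of positions at
  which both x and the reversed z have a one (km_gen_duality). Sum 1 - duality x z over x,
  weighted by the expected time that the process, started uniformly, spends in x. The resulting
  function of z, the potential, has generator -1 away from the origin, because the uniform average
  of duality x z vanishes there, and it is 0 at the origin: it is the expected time T(z) to reach
  the origin from z. As 1 - duality x z is twice the bit x ! i for the string z with i + 1 ones at
  the end, the expected number of steps is half the sum of T(0...01...1) over all numbers 1, ...,
  n of trailing ones. Time is cut off at a finite number of steps throughout, so that all sums are
  finite; the cutoff costs at most twice the survival probability in the generator.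

  It remains to estimate T at strings 0...01...1 linearly in the number of ones. By a maximum
  principle (km_gen_comparison) it suffices to exhibit functions whose generator is at most -1,
  respectively at least -1. These are built from the position of the leading one. Its drift is the
  length R of the run of ones that it starts, and the question is how fast it moves on average: an
  average speed of v gives T close to (number of ones) / v, hence n^2 / (4 v) expected steps. The
  bounds follow from a speed of at least 8227/5000 and at most 2.9.

  For the slowest speed, only finitely many bits after the leading one are observed; bits that
  enter this window are treated as chosen by an adversary. This is a finite decision problem, and
  its value function, stored at the leaves of a binary tree of contexts, is a certificate that is
  checked leaf by leaf (context_gain_le, upper_tree_check). For the fastest speed the same method
  bounds the truncated drift min R 32 by 2.384 (lower_tree_check). The remaining drift, the excess
  of R over 32, is unbounded and cannot be seen in a finite window. It is compensated by the
  explicit tail potential run_potential, a function of the lengths of the first three runs, whose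
  drift together with the excess is at most 3 * tail_const, which is below 0.516
  (run_potential_drift). As this potential grows only logarithmically in R, it does not affect the
  quadratic order.
\<close>


section \<open>The generator and its self-duality\<close>

abbreviation cube :: "nat \<Rightarrow> bool list set" where
  "cube n \<equiv> {x. length x = n}"

abbreviation origin :: "nat \<Rightarrow> bool list" where
  "origin n \<equiv> replicate n False"

definition ones :: "bool list \<Rightarrow> nat set" where
  "ones x = {s. s < length x \<and> x ! s}"

definition km_gen :: "(bool list \<Rightarrow> real) \<Rightarrow> bool list \<Rightarrow> real" where
  "km_gen f x = (\<Sum>s\<in>ones x. f (km_flip s x) - f x)"

lemma finite_ones [simp]: "finite (ones x)"
  by (auto simp: ones_def)

lemma length_km_flip [simp]: "length (km_flip s x) = length x"
  by (simp add: km_flip_def)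

lemma nth_km_flip:
  assumes "i < length x"
  shows "km_flip s x ! i = (if i < s then x ! i else \<not> x ! i)"
  using assms by (auto simp: km_flip_def nth_append min_def)

lemma ones_empty_iff: "ones x = {} \<longleftrightarrow> x = replicate (length x) False"
  by (auto simp: ones_def list_eq_iff_nth_eq)

lemma km_gen_alt:
  "km_gen f x = (\<Sum>s<length x. if x ! s then f (km_flip s x) - f x else 0)"
  unfolding km_gen_def ones_def by (rule sum.mono_neutral_cong_left) auto

lemma km_gen_one_minus: "km_gen (\<lambda>y. 1 - f y) x = - km_gen f x"
  by (simp add: km_gen_def sum_negf[symmetric])

lemma km_gen_sum: "km_gen (\<lambda>z. \<Sum>x\<in>A. c x * f x z) z = (\<Sum>x\<in>A. c x * km_gen (f x) z)"
proof -
  have "km_gen (\<lambda>z. \<Sum>x\<in>A. c x * f x z) z = (\<Sum>s\<in>ones z. \<Sum>x\<in>A. c x * (f x (km_flip s z) - f x z))"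
    by (simp add: km_gen_def right_diff_distrib sum_subtractf)
  also have "\<dots> = (\<Sum>x\<in>A. c x * km_gen (f x) z)"
    by (subst sum.swap) (simp add: km_gen_def sum_distrib_left)
  finally show ?thesis .
qed

lemma km_gen_diff: "km_gen (\<lambda>z. f z - g z) z = km_gen f z - km_gen g z"
  unfolding km_gen_def sum_subtractf[symmetric] by (intro sum.cong refl) simp

lemma km_gen_cmult: "km_gen (\<lambda>z. c * f z) z = c * km_gen f z"
  by (simp add: km_gen_def sum_distrib_left right_diff_distrib)

lemma km_gen_add: "km_gen (\<lambda>z. f z + g z) z = km_gen f z + km_gen g z"
  by (simp add: km_gen_def sum.distrib[symmetric] algebra_simps)

lemma km_gen_affine: "km_gen (\<lambda>z. a * (f z + c)) z = a * km_gen f z"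
  by (simp add: km_gen_def sum_distrib_left right_diff_distrib distrib_left)

text \<open>
  The changes of x along its positions, with a virtual 0 in front. They determine x, and a flip of
  x at s toggles exactly one of them.
\<close>
definition boundary :: "bool list \<Rightarrow> nat \<Rightarrow> bool" where
  "boundary x r \<longleftrightarrow> x ! r \<noteq> (0 < r \<and> x ! (r - 1))"

definition signed :: "bool \<Rightarrow> real" where
  "signed b = (if b then -1 else 1)"

text \<open>
  The second argument is read from right to left, which makes both actions a flip of a suffix of
  the respective string.
\<close>
definition duality :: "bool list \<Rightarrow> bool list \<Rightarrow> real" where
  "duality x z = (\<Prod>r<length x. signed (z ! (length x - 1 - r) \<and> boundary x r))"

lemma signed_simps [simp]: "signed True = -1" "signed False = 1"
  by (auto simp: signed_def)

lemma signed_not_conj: "signed (\<not> a \<and> b) = signed (a \<and> b) * signed b"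
  by (auto simp: signed_def)

lemma signed_conj_not: "signed (a \<and> \<not> b) = signed (a \<and> b) * signed a"
  by (auto simp: signed_def)

lemma boundary_km_flip:
  assumes "s < length x" "r < length x"
  shows "boundary (km_flip s x) r \<longleftrightarrow> (if r = s then \<not> boundary x r else boundary x r)"
proof (cases "0 < r")
  case True
  then show ?thesis
    using assms by (auto simp: boundary_def nth_km_flip)
next
  case False
  then show ?thesis
    using assms by (auto simp: boundary_def nth_km_flip)
qed

text \<open>
  The parity of the number of changes up to s is the value at s.
\<close>
lemma prod_signed_boundary:
  "(\<Prod>r\<le>s. signed (boundary x r)) = signed (x ! s)"
proof (induction s)
  case 0
  then show ?case by (simp add: boundary_def)
next
  case (Suc s)
  then show ?case by (auto simp: boundary_def signed_def)
qed

lemma duality_flip_left: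
  assumes "s < length x"
  shows "duality (km_flip s x) z = signed (z ! (length x - 1 - s)) * duality x z"
proof -
  let ?g = "\<lambda>r. signed (z ! (length x - 1 - r) \<and> boundary x r)"
  have "duality (km_flip s x) z = (\<Prod>r<length x. ?g r * (if r = s then signed (z ! (length x - 1 - s)) else 1))"
    unfolding duality_def length_km_flip using assms
    by (intro prod.cong) (auto simp: boundary_km_flip signed_conj_not)
  also have "\<dots> = duality x z * signed (z ! (length x - 1 - s))"
    using assms by (simp add: prod.distrib duality_def)
  finally show ?thesis by simp
qed

lemma duality_flip_right:
  assumes "k < length x" "length z = length x"
  shows "duality x (km_flip k z) = signed (x ! (length x - 1 - k)) * duality x z"
proof -
  define n where "n = length x"
  define s where "s = n - 1 - k"
  have s: "s < n" using assms by (simp add: s_def n_def)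
  let ?g = "\<lambda>r. signed (z ! (n - 1 - r) \<and> boundary x r)"
  have flip: "km_flip k z ! (n - Suc r) = (if r \<le> s then \<not> z ! (n - Suc r) else z ! (n - Suc r))" if "r < n" for r
    using that assms by (auto simp: nth_km_flip n_def s_def)
  have "duality x (km_flip k z) = (\<Prod>r<n. ?g r * (if r \<le> s then signed (boundary x r) else 1))"
    unfolding duality_def n_def[symmetric]
    by (intro prod.cong) (auto simp: flip signed_not_conj)
  also have "\<dots> = duality x z * (\<Prod>r\<in>{r\<in>{..<n}. r \<le> s}. signed (boundary x r))"
    by (simp add: prod.distrib duality_def n_def prod.If_cases Int_def)
  also have "{r\<in>{..<n}. r \<le> s} = {..s}" using s by auto
  finally show ?thesis by (simp add: prod_signed_boundary s_def n_def)
qed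

text \<open>
  Both sides are duality x z times -2 times the number of common ones of x and the reversal of z:
  a flip in either argument preserves or reverses the sign, according to whether the other
  argument has a one at the mirrored position.
\<close>
lemma km_gen_duality:
  assumes "length z = length x"
  shows "km_gen (\<lambda>x. duality x z) x = km_gen (duality x) z"
proof -
  define n where "n = length x"
  have "km_gen (\<lambda>x. duality x z) x = (\<Sum>s<n. if x ! s \<and> z ! (n - Suc s) then -2 * duality x z else 0)"
    unfolding km_gen_alt n_def[symmetric]
    by (intro sum.cong) (auto simp: duality_flip_left n_def[symmetric] signed_def)
  also have "\<dots> = (\<Sum>k<n. if x ! (n - Suc k) \<and> z ! k then -2 * duality x z else 0)"
    by (subst sum.nat_diff_reindex[symmetric]) (auto intro!: sum.cong simp: Suc_diff_Suc)
  also have "\<dots> = km_gen (duality x) z"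
    unfolding km_gen_alt assms n_def[symmetric]
    using assms
    by (intro sum.cong) (auto simp: duality_flip_right n_def[symmetric] signed_def)
  finally show ?thesis .
qed

lemma duality_zero_left: "duality (replicate n False) z = 1"
  by (auto simp: duality_def boundary_def signed_def)

lemma duality_zero_right: "length x = n \<Longrightarrow> duality x (replicate n False) = 1"
  by (auto simp: duality_def)

lemma abs_duality_le_1: "\<bar>duality x z\<bar> \<le> 1"
  unfolding duality_def by (auto simp: abs_prod signed_def intro!: prod_le_1)

lemma duality_suffix:
  assumes "length x = n" "i < n"
  shows "duality x (replicate (n - 1 - i) False @ replicate (i + 1) True) = signed (x ! i)"
proof -
  have "duality x (replicate (n - 1 - i) False @ replicate (i + 1) True) =
      (\<Prod>r<n. if r \<le> i then signed (boundary x r) else 1)"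
    unfolding duality_def assms(1) using assms(2)
    by (intro prod.cong) (auto simp: nth_append nth_Cons' split: if_splits)
  also have "\<dots> = (\<Prod>r\<in>{..i}. signed (boundary x r))"
    using assms(2) by (intro prod.mono_neutral_cong_right) auto
  finally show ?thesis by (simp add: prod_signed_boundary)
qed

text \<open>
  A one of z at the position mirrored to s makes the flip at s, which permutes the cube, reverse
  the sign.
\<close>
lemma sum_duality_zero:
  assumes "length z = n" "z \<noteq> replicate n False"
  shows "(\<Sum>x | length x = n. duality x z) = 0"
proof -
  obtain j where j: "j < n" "z ! j"
    using assms by (metis length_replicate list_eq_iff_nth_eq nth_replicate)
  define s where "s = n - 1 - j"
  have s: "s < n" "n - 1 - s = j" using j by (auto simp: s_def)
  have inv: "km_flip s (km_flip s x) = x" for x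
    by (auto simp: list_eq_iff_nth_eq nth_km_flip)
  have "(\<Sum>x | length x = n. duality x z) = (\<Sum>x | length x = n. duality (km_flip s x) z)"
    by (rule sum.reindex_bij_witness[of _ "km_flip s" "km_flip s"]) (auto simp: inv)
  also have "\<dots> = (\<Sum>x | length x = n. - duality x z)"
    using s j by (intro sum.cong) (auto simp: duality_flip_left)
  finally show ?thesis by (simp add: sum_negf)
qed


section \<open>The expected number of steps as a sum of survival probabilities\<close>

text \<open>
  The mass of the trajectories that stay in Q before time k and are in y at time k. For Q the cube
  without the origin this is the law of the chain at time k before absorption.
\<close>
fun alive_mass :: "nat \<Rightarrow> bool list set \<Rightarrow> nat \<Rightarrow> bool list \<Rightarrow> real" where
  "alive_mass n Q 0 y = pmf (km_init n) y"
| "alive_mass n Q (Suc k) y = (\<Sum>x\<in>Q. alive_mass n Q k x * pmf (km_step x) y)"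

lemma alive_mass_nonneg: "0 \<le> alive_mass n Q k y"
  by (induction k arbitrary: y) (auto intro!: sum_nonneg)

definition path_weight :: "nat \<Rightarrow> bool list list \<Rightarrow> real" where
  "path_weight n p = pmf (km_init n) (p ! 0) * (\<Prod>i<length p - 1. pmf (km_step (p ! i)) (p ! Suc i))"

lemma path_weight_nonneg: "0 \<le> path_weight n p"
  by (simp add: path_weight_def prod_nonneg)

lemma path_weight_snoc:
  assumes "p \<noteq> []"
  shows "path_weight n (p @ [y]) = path_weight n p * pmf (km_step (last p)) y"
proof -
  obtain k where k: "length p = Suc k" using assms by (cases p) auto
  have "(\<Prod>i<Suc k. pmf (km_step ((p @ [y]) ! i)) ((p @ [y]) ! Suc i)) =
      (\<Prod>i<k. pmf (km_step (p ! i)) (p ! Suc i)) * pmf (km_step (last p)) y"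
    using k assms by (auto simp: nth_append last_conv_nth intro!: arg_cong2[where f = "(*)"] prod.cong)
  then show ?thesis
    using k assms by (simp add: path_weight_def nth_append)
qed

lemma sum_path_weight:
  assumes "finite Q"
  shows "(\<Sum>p | set p \<subseteq> Q \<and> length p = k. path_weight n (p @ [y])) = alive_mass n Q k y"
proof (induction k arbitrary: y)
  case 0
  have "{p. set p \<subseteq> Q \<and> length p = 0} = {[]}" by auto
  then show ?case by (simp add: path_weight_def)
next
  case (Suc k)
  have eq: "{p. set p \<subseteq> Q \<and> length p = Suc k} = (\<lambda>(x, p). p @ [x]) ` (Q \<times> {p. set p \<subseteq> Q \<and> length p = k})"
    (is "?A = ?B")
  proof
    show "?A \<subseteq> ?B"
    proof
      fix p assume "p \<in> ?A"
      then show "p \<in> ?B"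
        by (cases p rule: rev_cases) (auto intro!: image_eqI[of _ _ "(last p, butlast p)"])
    qed
  qed auto
  have inj: "inj_on (\<lambda>(x, p). p @ [x]) (Q \<times> {p. set p \<subseteq> Q \<and> length p = k})"
    by (auto simp: inj_on_def)
  have "(\<Sum>p\<in>?A. path_weight n (p @ [y])) =
      (\<Sum>x\<in>Q. \<Sum>p | set p \<subseteq> Q \<and> length p = k. path_weight n ((p @ [x]) @ [y]))"
    unfolding eq by (subst sum.reindex[OF inj]) (simp add: sum.cartesian_product split_def)
  also have "\<dots> = (\<Sum>x\<in>Q. \<Sum>p | set p \<subseteq> Q \<and> length p = k. path_weight n (p @ [x]) * pmf (km_step x) y)"
    by (intro sum.cong refl) (subst path_weight_snoc, auto)
  also have "\<dots> = alive_mass n Q (Suc k) y"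
    by (simp add: sum_distrib_right[symmetric] Suc)
  finally show ?case .
qed

lemma km_chain_coordinate [measurable]:
  "(\<lambda>\<omega>. \<omega> t) \<in> measurable (km_chain n) (count_space UNIV :: bool list measure)"
  using measurable_component_singleton[of t UNIV "\<lambda>_. count_space UNIV"]
  by (simp add: measurable_cong_sets[OF sets_km_chain refl])

lemma space_km_chain [simp]: "space (km_chain n) = UNIV"
  using sets_eq_imp_space_eq[OF sets_km_chain[of n]] by (simp add: space_PiM)

lemma sets_km_chain_Collect [measurable (raw)]:
  "{\<omega>. P (\<omega> t)} \<in> sets (km_chain n)" for P :: "bool list \<Rightarrow> bool"
proof -
  have "(\<lambda>\<omega>. \<omega> t) -` {x. P x} \<inter> space (km_chain n) \<in> sets (km_chain n)"
    by (rule measurable_sets[OF km_chain_coordinate]) simp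
  then show ?thesis by (simp add: vimage_def)
qed

lemma sets_km_chain_bounded_all:
  "{\<omega>. \<forall>i\<le>k. P i (\<omega> i)} \<in> sets (km_chain n)" for P :: "nat \<Rightarrow> bool list \<Rightarrow> bool" and k :: nat
proof -
  have "{\<omega>. \<forall>i\<le>k. P i (\<omega> i)} = (\<Inter>i\<in>{..k}. {\<omega>. P i (\<omega> i)})" by auto
  also have "\<dots> \<in> sets (km_chain n)"
    by (intro sets.finite_INT) (auto intro: sets_km_chain_Collect)
  finally show ?thesis .
qed

lemma emeasure_km_chain_alive:
  assumes "finite Q"
  shows "emeasure (km_chain n) {\<omega>. (\<forall>i<k. \<omega> i \<in> Q) \<and> \<omega> k = y} = ennreal (alive_mass n Q k y)"
proof -
  let ?P = "{p. set p \<subseteq> Q \<and> length p = k}"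
  let ?C = "\<lambda>p. {\<omega>. \<forall>i\<le>k. \<omega> i = (p @ [y]) ! i}"
  have fin: "finite ?P" using finite_lists_length_eq[OF assms, of k] by simp
  have "{\<omega>. (\<forall>i<k. \<omega> i \<in> Q) \<and> \<omega> k = y} = (\<Union>p\<in>?P. ?C p)" (is "?A = ?B")
  proof
    show "?A \<subseteq> ?B"
    proof
      fix \<omega> assume "\<omega> \<in> ?A"
      then have "map \<omega> [0..<k] \<in> ?P" "\<omega> \<in> ?C (map \<omega> [0..<k])"
        by (auto simp: nth_append)
      then show "\<omega> \<in> ?B" by blast
    qed
    show "?B \<subseteq> ?A"
      by (auto simp: nth_append)
  qed
  also have "emeasure (km_chain n) \<dots> = (\<Sum>p\<in>?P. emeasure (km_chain n) (?C p))"
  proof (rule sum_emeasure[symmetric])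
    show "?C ` ?P \<subseteq> sets (km_chain n)" using sets_km_chain_bounded_all[of k "\<lambda>i x. x = _ i"] by auto
    show "disjoint_family_on ?C ?P"
      by (auto simp: disjoint_family_on_def list_eq_iff_nth_eq nth_append)
  qed (rule fin)
  also have "\<dots> = (\<Sum>p\<in>?P. ennreal (path_weight n (p @ [y])))"
    by (intro sum.cong refl) (auto simp: emeasure_km_chain_cylinder[of n k] path_weight_def)
  also have "\<dots> = ennreal (alive_mass n Q k y)"
    using sum_ennreal[of ?P "\<lambda>p. path_weight n (p @ [y])"]
    by (simp add: path_weight_nonneg sum_path_weight[OF assms])
  finally show ?thesis .
qed

lemma finite_cube [simp]: "finite (cube n)"
  using finite_lists_length_eq[of "UNIV::bool set" n] by simp

lemma cube_not_empty [simp]: "cube n \<noteq> {}"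
  by (rule ex_in_conv[THEN iffD1], rule exI[of _ "origin n"]) simp

lemma ones_nonempty:
  assumes "x \<in> cube n - {origin n}"
  shows "ones x \<noteq> {}"
  using assms ones_empty_iff[of x] by auto

lemma km_step_nonzero:
  assumes "x \<in> cube n - {origin n}"
  shows "km_step x = map_pmf (\<lambda>s. km_flip s x) (pmf_of_set (ones x))"
proof -
  have "\<exists>s<length x. x ! s" using ones_nonempty[OF assms] by (auto simp: ones_def)
  then show ?thesis by (simp add: km_step_def ones_def)
qed

lemma set_km_step:
  assumes "x \<in> cube n"
  shows "set_pmf (km_step x) \<subseteq> cube n"
proof (cases "x = origin n")
  case True
  then show ?thesis by (auto simp: km_step_def)
next
  case False
  then have x: "x \<in> cube n - {origin n}" using assms by simp
  show ?thesis
    unfolding km_step_nonzero[OF x] using ones_nonempty[OF x] x by (auto simp: set_pmf_of_set)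
qed

lemma sum_pmf_km_step:
  assumes "x \<in> cube n"
  shows "(\<Sum>y\<in>cube n. pmf (km_step x) y) = 1"
  using set_km_step[OF assms] by (intro sum_pmf_eq_1) auto

lemma sum_pmf_km_step_mult:
  assumes "x \<in> cube n - {origin n}"
  shows "(\<Sum>y\<in>cube n. pmf (km_step x) y * f y) = (\<Sum>s\<in>ones x. f (km_flip s x)) / real (card (ones x))"
proof -
  have "(\<Sum>y\<in>cube n. pmf (km_step x) y * f y) = measure_pmf.expectation (km_step x) f"
    using set_km_step[of x n] assms
    by (subst integral_measure_pmf_real[of "cube n"]) (auto simp: mult.commute)
  also have "\<dots> = measure_pmf.expectation (pmf_of_set (ones x)) (\<lambda>s. f (km_flip s x))"
    by (simp add: km_step_nonzero[OF assms])
  also have "\<dots> = (\<Sum>s\<in>ones x. f (km_flip s x)) / real (card (ones x))"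
    using ones_nonempty[OF assms] by (simp add: integral_pmf_of_set)
  finally show ?thesis .
qed

text \<open>
  The probability that the origin has not been reached up to and including time k.
\<close>
definition survival :: "nat \<Rightarrow> nat \<Rightarrow> real" where
  "survival n k = (\<Sum>y\<in>cube n - {origin n}. alive_mass n (cube n - {origin n}) k y)"

lemma survival_nonneg: "0 \<le> survival n k"
  by (simp add: survival_def sum_nonneg alive_mass_nonneg)

lemma alive_mass_cube_total: "(\<Sum>y\<in>cube n. alive_mass n (cube n) k y) = 1"
proof (induction k)
  case 0
  have "set_pmf (km_init n) \<subseteq> cube n"
    using finite_cube[of n] cube_not_empty[of n] by (simp add: km_init_def set_pmf_of_set)
  then show ?case by (auto intro!: sum_pmf_eq_1)
next
  case (Suc k)
  have "(\<Sum>y\<in>cube n. alive_mass n (cube n) (Suc k) y) =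
      (\<Sum>x\<in>cube n. \<Sum>y\<in>cube n. alive_mass n (cube n) k x * pmf (km_step x) y)"
    by (simp only: alive_mass.simps) (rule sum.swap)
  also have "\<dots> = (\<Sum>x\<in>cube n. alive_mass n (cube n) k x)"
    by (intro sum.cong refl) (simp add: sum_distrib_left[symmetric] sum_pmf_km_step)
  finally show ?case using Suc by simp
qed

lemma prob_space_km_chain: "prob_space (km_chain n)"
proof (rule prob_spaceI)
  let ?X = "space (PiM {} (\<lambda>_. count_space UNIV :: bool list measure)) :: (nat \<Rightarrow> bool list) set"
  have "prod_emb UNIV (\<lambda>_. count_space UNIV) {} ?X = (UNIV :: (nat \<Rightarrow> bool list) set)"
    by (auto simp: prod_emb_def space_PiM)
  then have "emeasure (km_chain n) (space (km_chain n)) = emeasure (KM.CI n {}) ?X"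
    using KM.lim[of "{}" ?X n] unfolding space_km_chain by (simp add: km_chain_def)
  also have "\<dots> = 1"
    using prob_space.emeasure_space_1[OF KM.PF.prob_space_P[of "{}" n]]
      sets_eq_imp_space_eq[OF KM.PF.sets_P[of "{}" n]] by simp
  finally show "emeasure (km_chain n) (space (km_chain n)) = 1" .
qed

lemma emeasure_UN_alive:
  assumes "finite Q" "finite Y"
  shows "emeasure (km_chain n) {\<omega>. (\<forall>i<k. \<omega> i \<in> Q) \<and> \<omega> k \<in> Y} = ennreal (\<Sum>y\<in>Y. alive_mass n Q k y)"
proof -
  let ?C = "\<lambda>y. {\<omega>. (\<forall>i<k. \<omega> i \<in> Q) \<and> \<omega> k = y}"
  have C: "?C y \<in> sets (km_chain n)" for y
  proof -
    have "?C y = {\<omega>. \<forall>i\<le>k. if i < k then \<omega> i \<in> Q else \<omega> i = y}"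
      by (auto simp: le_less)
    then show ?thesis
      using sets_km_chain_bounded_all[of k "\<lambda>i x. if i < k then x \<in> Q else x = y" n] by simp
  qed
  have "{\<omega>. (\<forall>i<k. \<omega> i \<in> Q) \<and> \<omega> k \<in> Y} = (\<Union>y\<in>Y. ?C y)" by auto
  also have "emeasure (km_chain n) \<dots> = (\<Sum>y\<in>Y. emeasure (km_chain n) (?C y))"
    using C assms(2) by (intro sum_emeasure[symmetric]) (auto simp: disjoint_family_on_def)
  also have "\<dots> = ennreal (\<Sum>y\<in>Y. alive_mass n Q k y)"
    by (simp add: emeasure_km_chain_alive[OF assms(1)] sum_ennreal alive_mass_nonneg)
  finally show ?thesis .
qed

text \<open>
  The trajectory space contains lists of every length; the chain leaves the cube with probability
  0.
\<close>
lemma AE_km_chain_cube: "AE \<omega> in km_chain n. \<forall>k. \<omega> k \<in> cube n"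
proof (subst AE_all_countable, rule allI)
  fix k
  interpret prob_space "km_chain n" by (rule prob_space_km_chain)
  have "emeasure (km_chain n) {\<omega>. (\<forall>i<k. \<omega> i \<in> cube n) \<and> \<omega> k \<in> cube n} = 1"
    using emeasure_UN_alive[of "cube n" "cube n" n k] by (simp add: alive_mass_cube_total)
  also have "{\<omega>. (\<forall>i<k. \<omega> i \<in> cube n) \<and> \<omega> k \<in> cube n} = {\<omega>. \<forall>i\<le>k. \<omega> i \<in> cube n}"
    by (auto simp: le_less)
  finally have "AE \<omega> in km_chain n. \<omega> \<in> {\<omega>. \<forall>i\<le>k. \<omega> i \<in> cube n}"
    using sets_km_chain_bounded_all[of k "\<lambda>i x. x \<in> cube n" n]
    by (intro AE_in_set_eq_1[THEN iffD2]) (auto simp: emeasure_eq_measure)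
  then show "AE \<omega> in km_chain n. \<omega> k \<in> cube n" by (rule AE_mp) auto
qed

lemma emeasure_km_chain_survival:
  "emeasure (km_chain n) {\<omega>. \<forall>i\<le>k. \<omega> i \<noteq> origin n} = ennreal (survival n k)"
proof -
  have "emeasure (km_chain n) {\<omega>. \<forall>i\<le>k. \<omega> i \<noteq> origin n} =
      emeasure (km_chain n) {\<omega>. \<forall>i\<le>k. \<omega> i \<in> cube n - {origin n}}"
    using AE_km_chain_cube[of n]
    by (intro emeasure_eq_AE sets_km_chain_bounded_all) (auto elim!: eventually_mono)
  also have "{\<omega>. \<forall>i\<le>k. \<omega> i \<in> cube n - {origin n}} =
      {\<omega>. (\<forall>i<k. \<omega> i \<in> cube n - {origin n}) \<and> \<omega> k \<in> cube n - {origin n}}"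
    by (auto simp: le_less)
  also have "emeasure (km_chain n) \<dots> = ennreal (survival n k)"
    unfolding survival_def by (rule emeasure_UN_alive) simp_all
  finally show ?thesis .
qed

text \<open>
  The hitting time counts the times before which the origin has not been visited, also when it is
  infinite.
\<close>
lemma km_steps_tail_sum:
  "ennreal_of_enat (km_steps n \<omega>) = (\<Sum>k. indicator {\<omega>. \<forall>i\<le>k. \<omega> i \<noteq> origin n} \<omega>)"
proof (cases "\<exists>t. \<omega> t = origin n")
  case True
  define t where "t = (LEAST t. \<omega> t = origin n)"
  have t: "\<omega> t = origin n" unfolding t_def using True by (rule LeastI_ex)
  have least: "t \<le> s" if "\<omega> s = origin n" for s unfolding t_def using that by (rule Least_le)
  have "km_steps n \<omega> = enat t"
    unfolding km_steps_def
  proof (rule antisym)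
    show "(INF t\<in>{t. \<omega> t = origin n}. enat t) \<le> enat t"
      by (rule INF_lower) (simp add: t)
    show "enat t \<le> (INF t\<in>{t. \<omega> t = origin n}. enat t)"
      by (rule INF_greatest) (simp add: least)
  qed
  moreover have "(\<Sum>k. indicator {\<omega>. \<forall>i\<le>k. \<omega> i \<noteq> origin n} \<omega> :: ennreal) = (\<Sum>k<t. 1)"
  proof (subst suminf_finite[of "{..<t}"])
    show "indicator {\<omega>. \<forall>i\<le>k. \<omega> i \<noteq> origin n} \<omega> = (0::ennreal)" if "k \<notin> {..<t}" for k
      using that t by (auto simp: indicator_def intro!: exI[of _ t])
    show "(\<Sum>k<t. indicator {\<omega>. \<forall>i\<le>k. \<omega> i \<noteq> origin n} \<omega> :: ennreal) = (\<Sum>k<t. 1)"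
    proof (intro sum.cong refl)
      fix k assume "k \<in> {..<t}"
      then have "\<forall>i\<le>k. \<omega> i \<noteq> origin n" using least by force
      then show "indicator {\<omega>. \<forall>i\<le>k. \<omega> i \<noteq> origin n} \<omega> = (1::ennreal)" by simp
    qed
  qed simp
  ultimately show ?thesis by (simp add: ennreal_of_nat_eq_real_of_nat)
next
  case False
  then have "km_steps n \<omega> = \<infinity>"
    by (auto simp: km_steps_def top_enat_def)
  moreover have "(\<Sum>k. indicator {\<omega>. \<forall>i\<le>k. \<omega> i \<noteq> origin n} \<omega>) = (\<Sum>k::nat. 1::ennreal)"
    using False by (intro suminf_cong) simp
  moreover have "(\<Sum>k::nat. 1::ennreal) = \<infinity>"
  proof -
    have "(\<Sum>k<m. 1::ennreal) = of_nat m" for m :: nat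
      by (simp only: sum_constant card_lessThan mult_1_right)
    then show ?thesis
      unfolding suminf_eq_SUP by (simp only: ennreal_SUP_of_nat_eq_top) simp
  qed
  ultimately show ?thesis by simp
qed

lemma km_expected_steps_eq: "km_expected_steps n = (\<Sum>k. ennreal (survival n k))"
proof -
  have meas: "{\<omega>. \<forall>i\<le>k. \<omega> i \<noteq> origin n} \<in> sets (km_chain n)" for k
    using sets_km_chain_bounded_all[of k "\<lambda>i x. x \<noteq> origin n" n] by simp
  have "km_expected_steps n = (\<Sum>k. \<integral>\<^sup>+\<omega>. indicator {\<omega>. \<forall>i\<le>k. \<omega> i \<noteq> origin n} \<omega> \<partial>km_chain n)"
    unfolding km_expected_steps_def km_steps_tail_sum
    using meas by (intro nn_integral_suminf) auto
  also have "\<dots> = (\<Sum>k. ennreal (survival n k))"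
    using meas by (simp add: emeasure_km_chain_survival)
  finally show ?thesis .
qed


section \<open>Expected occupation times and the dual potential\<close>

text \<open>
  The expected continuous time spent in x during the first K steps: every visit lasts 1 / card
  (ones x) on average.
\<close>
definition occupation :: "nat \<Rightarrow> nat \<Rightarrow> bool list \<Rightarrow> real" where
  "occupation n K x = (\<Sum>k<K. alive_mass n (cube n - {origin n}) k x) / real (card (ones x))"

lemma alive_mass_step:
  assumes "f (origin n) = 0"
  shows "(\<Sum>y\<in>cube n - {origin n}. alive_mass n (cube n - {origin n}) (Suc k) y * f y) =
    (\<Sum>x\<in>cube n - {origin n}. alive_mass n (cube n - {origin n}) k x *
       ((\<Sum>s\<in>ones x. f (km_flip s x)) / real (card (ones x))))"
proof -
  let ?Q = "cube n - {origin n}"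
  have "(\<Sum>y\<in>?Q. alive_mass n ?Q (Suc k) y * f y) = (\<Sum>y\<in>cube n. alive_mass n ?Q (Suc k) y * f y)"
    using assms by (intro sum.mono_neutral_left) auto
  also have "\<dots> = (\<Sum>x\<in>?Q. alive_mass n ?Q k x * (\<Sum>y\<in>cube n. pmf (km_step x) y * f y))"
    by (simp only: alive_mass.simps sum_distrib_right sum_distrib_left mult.assoc) (rule sum.swap)
  also have "\<dots> = (\<Sum>x\<in>?Q. alive_mass n ?Q k x * ((\<Sum>s\<in>ones x. f (km_flip s x)) / real (card (ones x))))"
    by (intro sum.cong refl) (simp only: sum_pmf_km_step_mult)
  finally show ?thesis .
qed

text \<open>
  Multiplying the generator by the occupation time turns it into the increment of the expectation
  over one step, and these increments telescope. The condition on f removes the contribution of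
  the absorbed mass.
\<close>
lemma Green_identity:
  assumes "f (origin n) = 0"
  shows "(\<Sum>x\<in>cube n - {origin n}. occupation n K x * km_gen f x) =
    (\<Sum>x\<in>cube n - {origin n}. alive_mass n (cube n - {origin n}) K x * f x) -
    (\<Sum>x\<in>cube n - {origin n}. pmf (km_init n) x * f x)"
proof -
  let ?Q = "cube n - {origin n}"
  let ?w = "alive_mass n ?Q"
  have gen: "km_gen f x / real (card (ones x)) = (\<Sum>s\<in>ones x. f (km_flip s x)) / real (card (ones x)) - f x"
    if "x \<in> ?Q" for x
    using ones_nonempty[OF that] by (simp add: km_gen_def sum_subtractf diff_divide_distrib)
  have "(\<Sum>x\<in>?Q. occupation n K x * km_gen f x) =
      (\<Sum>x\<in>?Q. \<Sum>k<K. ?w k x * (km_gen f x / real (card (ones x))))"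
    by (simp add: occupation_def sum_distrib_right sum_divide_distrib)
  also have "\<dots> = (\<Sum>k<K. \<Sum>x\<in>?Q. ?w k x * (km_gen f x / real (card (ones x))))"
    by (rule sum.swap)
  also have "\<dots> = (\<Sum>k<K. (\<Sum>x\<in>?Q. ?w (Suc k) x * f x) - (\<Sum>x\<in>?Q. ?w k x * f x))"
    unfolding alive_mass_step[where f = f, OF assms]
    by (intro sum.cong refl) (simp add: gen right_diff_distrib sum_subtractf)
  also have "\<dots> = (\<Sum>x\<in>?Q. ?w K x * f x) - (\<Sum>x\<in>?Q. ?w 0 x * f x)"
    by (rule sum_lessThan_telescope)
  finally show ?thesis by simp
qed

lemma sum_survival: "(\<Sum>k<K. survival n k) = (\<Sum>x\<in>cube n - {origin n}. occupation n K x * real (card (ones x)))"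
proof -
  let ?Q = "cube n - {origin n}"
  have "(\<Sum>k<K. survival n k) = (\<Sum>x\<in>?Q. \<Sum>k<K. alive_mass n ?Q k x)"
    unfolding survival_def by (rule sum.swap)
  also have "\<dots> = (\<Sum>x\<in>?Q. occupation n K x * real (card (ones x)))"
    using ones_nonempty by (intro sum.cong refl) (auto simp: occupation_def)
  finally show ?thesis .
qed

text \<open>
  As K tends to infinity this becomes the expected absorption time of the process started in z.
\<close>
definition potential :: "nat \<Rightarrow> nat \<Rightarrow> bool list \<Rightarrow> real" where
  "potential n K z = (\<Sum>x\<in>cube n - {origin n}. occupation n K x * (1 - duality x z))"

lemma potential_origin: "potential n K (origin n) = 0"
  by (auto simp: potential_def duality_zero_right intro!: sum.neutral)

text \<open>
  The duality moves the generator from z to x, where the Green identity applies. The initial term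
  is the uniform average of 1 - duality x z, that is 1.
\<close>
lemma km_gen_potential:
  assumes "length z = n" "z \<noteq> origin n"
  shows "km_gen (potential n K) z =
    (\<Sum>x\<in>cube n - {origin n}. alive_mass n (cube n - {origin n}) K x * (1 - duality x z)) - 1"
proof -
  let ?Q = "cube n - {origin n}"
  have "km_gen (potential n K) z = (\<Sum>x\<in>?Q. occupation n K x * km_gen (\<lambda>z. 1 - duality x z) z)"
    unfolding potential_def[abs_def] by (rule km_gen_sum)
  also have "\<dots> = (\<Sum>x\<in>?Q. occupation n K x * km_gen (\<lambda>x. 1 - duality x z) x)"
    using assms by (intro sum.cong refl) (simp only: km_gen_one_minus, simp add: km_gen_duality)
  also have "\<dots> = (\<Sum>x\<in>?Q. alive_mass n ?Q K x * (1 - duality x z)) - (\<Sum>x\<in>?Q. pmf (km_init n) x * (1 - duality x z))"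
    by (rule Green_identity) (simp add: duality_zero_left)
  also have "(\<Sum>x\<in>?Q. pmf (km_init n) x * (1 - duality x z)) = (\<Sum>x\<in>cube n. pmf (km_init n) x * (1 - duality x z))"
  proof (rule sum.mono_neutral_left)
    show "\<forall>x\<in>cube n - ?Q. pmf (km_init n) x * (1 - duality x z) = 0"
    proof
      fix x assume "x \<in> cube n - ?Q"
      then have x: "x = origin n" by blast
      show "pmf (km_init n) x * (1 - duality x z) = 0" unfolding x by (simp add: duality_zero_left)
    qed
  qed auto
  also have "\<dots> = (\<Sum>x\<in>cube n. (1 - duality x z)) / real (card (cube n))"
    using cube_not_empty[of n] unfolding sum_divide_distrib
    by (intro sum.cong refl) (simp add: km_init_def indicator_def del: Collect_empty_eq)
  also have "(\<Sum>x\<in>cube n. (1 - duality x z)) = real (card (cube n))"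
    using sum_duality_zero[OF assms] by (simp add: sum_subtractf)
  also have "real (card (cube n)) / real (card (cube n)) = 1"
  proof -
    have "card (cube n) \<noteq> 0" using card_0_eq[OF finite_cube[of n]] cube_not_empty[of n] by metis
    then show ?thesis by simp
  qed
  finally show ?thesis .
qed

lemma km_gen_potential_ge:
  assumes "length z = n" "z \<noteq> origin n"
  shows "- 1 \<le> km_gen (potential n K) z"
  unfolding km_gen_potential[OF assms]
  by (auto intro!: sum_nonneg mult_nonneg_nonneg alive_mass_nonneg simp: abs_duality_le_1 abs_le_D1)

lemma km_gen_potential_le:
  assumes "length z = n" "z \<noteq> origin n"
  shows "km_gen (potential n K) z \<le> 2 * survival n K - 1"
proof -
  let ?Q = "cube n - {origin n}"
  have "1 - duality x z \<le> 2" for x using abs_duality_le_1[of x z] by linarith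
  then have "(\<Sum>x\<in>?Q. alive_mass n ?Q K x * (1 - duality x z)) \<le> (\<Sum>x\<in>?Q. alive_mass n ?Q K x * 2)"
    by (intro sum_mono mult_left_mono alive_mass_nonneg)
  also have "\<dots> = 2 * survival n K" by (simp add: survival_def sum_distrib_left mult.commute)
  finally show ?thesis unfolding km_gen_potential[OF assms] by simp
qed

definition suffix_ones :: "nat \<Rightarrow> nat \<Rightarrow> bool list" where
  "suffix_ones n i = replicate (n - 1 - i) False @ replicate (i + 1) True"

text \<open>
  Against the string with i + 1 trailing ones, the duality function is the sign of the bit x ! i.
\<close>
lemma card_ones_duality:
  assumes "x \<in> cube n"
  shows "real (card (ones x)) = (\<Sum>i<n. 1 - duality x (suffix_ones n i)) / 2"
proof -
  have "(\<Sum>i<n. 1 - duality x (suffix_ones n i)) = (\<Sum>i<n. if x ! i then 2 else 0)"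
    using assms unfolding suffix_ones_def
    by (intro sum.cong refl) (subst duality_suffix, auto simp: signed_def)
  also have "\<dots> = 2 * real (card (ones x))"
    using assms by (simp add: ones_def sum.If_cases Int_def conj_commute)
  finally show ?thesis by simp
qed

text \<open>
  The number of steps is the occupation time weighted by the number of ones, and the ones are read
  off bit by bit by the duality.
\<close>
lemma sum_survival_potential:
  "(\<Sum>k<K. survival n k) = (\<Sum>i<n. potential n K (suffix_ones n i)) / 2"
proof -
  let ?Q = "cube n - {origin n}"
  have "(\<Sum>k<K. survival n k) = (\<Sum>x\<in>?Q. occupation n K x * ((\<Sum>i<n. 1 - duality x (suffix_ones n i)) / 2))"
    unfolding sum_survival
    by (intro sum.cong refl arg_cong2[where f = "(*)"] card_ones_duality) blast
  also have "\<dots> = (\<Sum>x\<in>?Q. \<Sum>i<n. occupation n K x * (1 - duality x (suffix_ones n i))) / 2"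
    by (simp add: sum_distrib_left sum_divide_distrib)
  also have "\<dots> = (\<Sum>i<n. potential n K (suffix_ones n i)) / 2"
    by (subst sum.swap) (simp add: potential_def)
  finally show ?thesis .
qed


section \<open>The comparison principle\<close>

definition lead :: "bool list \<Rightarrow> nat" where
  "lead z = length (takeWhile Not z)"

lemma lead_le: "lead z \<le> length z"
  by (simp add: lead_def length_takeWhile_le)

lemma nth_less_lead: "i < lead z \<Longrightarrow> \<not> z ! i"
  unfolding lead_def by (metis nth_mem set_takeWhileD takeWhile_nth)

lemma nth_lead: "lead z < length z \<Longrightarrow> z ! lead z"
  unfolding lead_def using nth_length_takeWhile[of Not z] by simp

lemma lead_in_ones: "lead z < length z \<Longrightarrow> lead z \<in> ones z"
  by (simp add: ones_def nth_lead)

lemma lead_flip_lead: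
  assumes "lead z < length z"
  shows "lead z < lead (km_flip (lead z) z)"
proof (rule ccontr)
  assume "\<not> lead z < lead (km_flip (lead z) z)"
  then have le: "lead (km_flip (lead z) z) \<le> lead z" by simp
  then have "lead (km_flip (lead z) z) < length (km_flip (lead z) z)" using assms by simp
  then have "km_flip (lead z) z ! lead (km_flip (lead z) z)" by (rule nth_lead)
  moreover have "\<not> km_flip (lead z) z ! i" if "i \<le> lead z" for i
    using that assms nth_lead[OF assms] nth_less_lead[of i z] by (auto simp: nth_km_flip)
  ultimately show False using le by blast
qed

text \<open>
  Among the maximizers of D choose one whose leading one is as far to the right as possible.
  Outside the target, a nonnegative generator at a maximizer forces all its neighbours to be
  maximizers, but flipping the leading one moves it to the right.
\<close>
lemma km_gen_comparison:
  fixes D :: "bool list \<Rightarrow> real"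
  assumes gen: "\<And>z. length z = N \<Longrightarrow> \<not> target z \<Longrightarrow> 0 \<le> km_gen D z"
    and target: "\<And>z. length z = N \<Longrightarrow> target z \<Longrightarrow> D z \<le> c"
    and zero: "target (replicate N False)"
    and z: "length z = N"
  shows "D z \<le> c"
proof -
  let ?S = "{z::bool list. length z = N}"
  have fin: "finite ?S"
    using finite_lists_length_eq[of "UNIV::bool set" N] by simp
  define m where "m = Max (D ` ?S)"
  have m_ge: "D z \<le> m" if "length z = N" for z
    unfolding m_def using fin that by (intro Max_ge) auto
  have "m \<in> D ` ?S"
    unfolding m_def using fin z by (intro Max_in) auto
  then have "\<exists>z. length z = N \<and> D z = m" by auto
  then obtain z0 where z0: "length z0 = N \<and> D z0 = m" by blast
  \<comment> \<open>The maximizer with the rightmost leading one.\<close>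
  define w where "w = arg_max lead (\<lambda>z. length z = N \<and> D z = m)"
  have bound: "\<forall>z. length z = N \<and> D z = m \<longrightarrow> lead z \<le> N"
    using lead_le by blast
  have w: "length w = N" "D w = m"
    using arg_max_natI[of "\<lambda>z. length z = N \<and> D z = m" z0 lead "Suc N"] z0 bound
    unfolding w_def by (auto simp: less_Suc_eq_le)
  have w_max: "lead z \<le> lead w" if "length z = N" "D z = m" for z
    using arg_max_nat_le[of "\<lambda>z. length z = N \<and> D z = m" z lead "Suc N"] that bound
    unfolding w_def by (auto simp: less_Suc_eq_le)
  have "target w"
  proof (rule ccontr)
    assume nt: "\<not> target w"
    have lw: "lead w < length w"
    proof (rule ccontr)
      assume "\<not> lead w < length w"
      then have "w = replicate N False"
        using nth_less_lead[of _ w] w(1) by (auto simp: list_eq_iff_nth_eq)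
      then show False using nt zero by simp
    qed
    have nonpos: "D (km_flip s w) - D w \<le> 0" for s
      using m_ge[of "km_flip s w"] w by simp
    have "km_gen D w = 0"
    proof (rule antisym)
      show "km_gen D w \<le> 0" unfolding km_gen_def by (rule sum_nonpos) (rule nonpos)
      show "0 \<le> km_gen D w" using gen w nt by blast
    qed
    then have "(\<Sum>s\<in>ones w. D w - D (km_flip s w)) = 0"
      by (simp add: km_gen_def sum_subtractf)
    then have "D w - D (km_flip (lead w) w) = 0"
      using nonpos lead_in_ones[OF lw]
      by (subst (asm) sum_nonneg_eq_0_iff) auto
    then have "lead (km_flip (lead w) w) \<le> lead w" using w w_max by simp
    then show False using lead_flip_lead[OF lw] by simp
  qed
  then have "m \<le> c" using target w by blast
  then show ?thesis using m_ge[OF z] by simp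
qed

lemma take_km_flip: "take n (km_flip s z) = (if s < n then km_flip s (take n z) else take n z)"
  by (auto simp: km_flip_def take_map drop_take min_def)

text \<open>
  Flips propagate to the right only, so the first n bits form the same process, whatever stands
  behind them.
\<close>
lemma km_gen_take:
  assumes "n \<le> length z"
  shows "km_gen (\<lambda>z. f (take n z)) z = km_gen f (take n z)"
proof -
  have "km_gen (\<lambda>z. f (take n z)) z =
      (\<Sum>s<length z. if s < n \<and> z ! s then f (km_flip s (take n z)) - f (take n z) else 0)"
    unfolding km_gen_alt by (intro sum.cong) (auto simp: take_km_flip)
  also have "\<dots> = (\<Sum>s<n. if z ! s then f (km_flip s (take n z)) - f (take n z) else 0)"
    using assms by (intro sum.mono_neutral_cong_right) auto
  finally show ?thesis using assms by (simp add: km_gen_alt min_def)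
qed

lemma take_eq_origin_iff:
  assumes "length z = n + d"
  shows "take n z = origin n \<longleftrightarrow> n \<le> lead z"
proof
  assume *: "take n z = origin n"
  have "\<not> z ! i" if "i < n" for i
    using arg_cong[OF *, of "\<lambda>l. l ! i"] that assms by simp
  then show "n \<le> lead z"
    using nth_lead[of z] assms by (metis le_add1 not_le order.strict_trans2)
next
  assume "n \<le> lead z"
  then show "take n z = origin n"
    using assms nth_less_lead[of _ z] by (auto simp: list_eq_iff_nth_eq)
qed

text \<open>
  The padding by d further bits lets a function depend on d bits after the leading one even when
  that one is close to position n.
\<close>
lemma potential_le:
  assumes gen: "\<And>z. length z = n + d \<Longrightarrow> lead z < n \<Longrightarrow> km_gen \<Phi> z \<le> -1"
    and nonneg: "\<And>z. length z = n + d \<Longrightarrow> n \<le> lead z \<Longrightarrow> 0 \<le> \<Phi> z"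
    and z: "length z = n + d"
  shows "potential n K (take n z) \<le> \<Phi> z"
proof -
  note zero = take_eq_origin_iff[of _ n d]
  have "potential n K (take n z) - \<Phi> z \<le> 0"
  proof (rule km_gen_comparison[where D = "\<lambda>z. potential n K (take n z) - \<Phi> z" and c = 0 and N = "n + d" and target = "\<lambda>z. n \<le> lead z"])
    fix z :: "bool list" assume l: "length z = n + d" and "\<not> n \<le> lead z"
    then have "take n z \<noteq> origin n" "lead z < n" using zero by auto
    then show "0 \<le> km_gen (\<lambda>z. potential n K (take n z) - \<Phi> z) z"
      using km_gen_potential_ge[of "take n z" n K] gen[OF l] l
      unfolding km_gen_diff by (subst km_gen_take) auto
  next
    fix z :: "bool list" assume "length z = n + d" "n \<le> lead z"
    then show "potential n K (take n z) - \<Phi> z \<le> 0"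
      using nonneg[of z] zero[of z] by (simp add: potential_origin)
  next
    show "n \<le> lead (replicate (n + d) False)" by (simp add: lead_def)
  qed (rule z)
  then show ?thesis by simp
qed

text \<open>
  The generator of the truncated potential can exceed -1 by twice the survival probability, so the
  comparison function is scaled down accordingly.
\<close>
lemma potential_ge:
  assumes gen: "\<And>z. length z = n + d \<Longrightarrow> lead z < n \<Longrightarrow> -1 \<le> km_gen \<Phi> z"
    and nonpos: "\<And>z. length z = n + d \<Longrightarrow> n \<le> lead z \<Longrightarrow> \<Phi> z \<le> 0"
    and z: "length z = n + d"
    and K: "2 * survival n K \<le> 1"
  shows "(1 - 2 * survival n K) * \<Phi> z \<le> potential n K (take n z)"
proof -
  define c where "c = 1 - 2 * survival n K"
  have c: "0 \<le> c" using K by (simp add: c_def)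
  note zero = take_eq_origin_iff[of _ n d]
  have "c * \<Phi> z - potential n K (take n z) \<le> 0"
  proof (rule km_gen_comparison[where D = "\<lambda>z. c * \<Phi> z - potential n K (take n z)" and c = 0 and N = "n + d" and target = "\<lambda>z. n \<le> lead z"])
    fix z :: "bool list" assume l: "length z = n + d" and "\<not> n \<le> lead z"
    then have t: "take n z \<noteq> origin n" "lead z < n" using zero by auto
    have "- c \<le> c * km_gen \<Phi> z" using mult_left_mono[OF gen[OF l t(2)] c] by simp
    then show "0 \<le> km_gen (\<lambda>z. c * \<Phi> z - potential n K (take n z)) z"
      using km_gen_potential_le[of "take n z" n K] t l
      unfolding km_gen_diff km_gen_cmult by (subst km_gen_take) (auto simp: c_def)
  next
    fix z :: "bool list" assume "length z = n + d" "n \<le> lead z"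
    then show "c * \<Phi> z - potential n K (take n z) \<le> 0"
      using nonpos[of z] zero[of z] c by (simp add: potential_origin mult_nonneg_nonpos)
  next
    show "n \<le> lead (replicate (n + d) False)" by (simp add: lead_def)
  qed (rule z)
  then show ?thesis by (simp add: c_def)
qed

lemma km_expected_steps_le:
  assumes "\<And>i K. i < n \<Longrightarrow> potential n K (suffix_ones n i) \<le> b i"
  shows "km_expected_steps n \<le> ennreal ((\<Sum>i<n. b i) / 2)"
  unfolding km_expected_steps_eq
proof (rule suminf_le_const)
  fix K
  have "(\<Sum>k<K. ennreal (survival n k)) = ennreal (\<Sum>k<K. survival n k)"
    by (simp add: sum_ennreal survival_nonneg)
  also have "\<dots> \<le> ennreal ((\<Sum>i<n. b i) / 2)"
    unfolding sum_survival_potential using assms by (intro ennreal_leI divide_right_mono sum_mono) auto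
  finally show "(\<Sum>k<K. ennreal (survival n k)) \<le> ennreal ((\<Sum>i<n. b i) / 2)" .
qed simp

text \<open>
  Finiteness makes the survival probabilities tend to 0, which removes the scaling factor of the
  truncated estimate.
\<close>
lemma km_expected_steps_ge:
  assumes finite: "km_expected_steps n \<noteq> \<infinity>"
    and low: "\<And>i K. i < n \<Longrightarrow> 2 * survival n K \<le> 1 \<Longrightarrow>
      (1 - 2 * survival n K) * b i \<le> potential n K (suffix_ones n i)"
  shows "ennreal ((\<Sum>i<n. b i) / 2) \<le> km_expected_steps n"
proof -
  have sm: "summable (survival n)"
    using finite unfolding km_expected_steps_eq
    by (intro summable_suminf_not_top) (auto simp: survival_nonneg)
  then have lim0: "survival n \<longlonglongrightarrow> 0" by (rule summable_LIMSEQ_zero)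
  have "(\<lambda>K. (1 - 2 * survival n K) * (\<Sum>i<n. b i) / 2) \<longlonglongrightarrow> (1 - 2 * 0) * (\<Sum>i<n. b i) / 2"
    by (intro tendsto_intros lim0) simp
  moreover have "(\<lambda>K. \<Sum>k<K. survival n k) \<longlonglongrightarrow> (\<Sum>k. survival n k)"
    using summable_sums[OF sm] by (simp add: sums_def)
  moreover have "\<forall>\<^sub>F K in sequentially. (1 - 2 * survival n K) * (\<Sum>i<n. b i) / 2 \<le> (\<Sum>k<K. survival n k)"
  proof -
    have "\<forall>\<^sub>F K in sequentially. survival n K < 1 / 2"
      using lim0 by (rule order_tendstoD) simp
    then show ?thesis
    proof eventually_elim
      fix K assume "survival n K < 1 / 2"
      then have "(\<Sum>i<n. (1 - 2 * survival n K) * b i) \<le> (\<Sum>i<n. potential n K (suffix_ones n i))"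
        using low by (intro sum_mono) auto
      then show "(1 - 2 * survival n K) * (\<Sum>i<n. b i) / 2 \<le> (\<Sum>k<K. survival n k)"
        unfolding sum_survival_potential by (simp add: sum_distrib_left)
    qed
  qed
  ultimately have "(\<Sum>i<n. b i) / 2 \<le> (\<Sum>k. survival n k)"
    using tendsto_le[OF sequentially_bot] by fastforce
  moreover have "km_expected_steps n = ennreal (\<Sum>k. survival n k)"
    unfolding km_expected_steps_eq by (rule suminf_ennreal2) (auto simp: survival_nonneg sm)
  ultimately show ?thesis by (simp add: ennreal_leI)
qed


section \<open>Certificates on finite contexts after the leading one\<close>

text \<open>
  A function of the bits after the leading one that inspects finitely many of them; a branch reads
  the next bit, with the left subtree for 0.
\<close>
datatype context_tree = Leaf int | Branch context_tree context_tree

text \<open>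
  If the bits end before a leaf is reached, the missing ones are chosen so as to minimize the
  value. This is the adversary for bits that are not part of the observed context.
\<close>
fun least_value :: "context_tree \<Rightarrow> bool list \<Rightarrow> int" where
  "least_value (Leaf c) bs = c"
| "least_value (Branch l r) [] = min (least_value l []) (least_value r [])"
| "least_value (Branch l r) (b # bs) = least_value (if b then r else l) bs"

fun depth :: "context_tree \<Rightarrow> nat" where
  "depth (Leaf c) = 0"
| "depth (Branch l r) = Suc (max (depth l) (depth r))"

fun contexts :: "context_tree \<Rightarrow> bool list list" where
  "contexts (Leaf c) = [[]]"
| "contexts (Branch l r) = map (Cons False) (contexts l) @ map (Cons True) (contexts r)"

fun context_of :: "context_tree \<Rightarrow> bool list \<Rightarrow> bool list" where
  "context_of (Branch l r) (b # bs) = b # context_of (if b then r else l) bs"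
| "context_of t bs = []"

text \<open>
  The change of value, relative to c, under all flips inside the context, counted from below
  because the flipped context may be too short for the tree.
\<close>
fun flip_gain :: "context_tree \<Rightarrow> int \<Rightarrow> bool list \<Rightarrow> int" where
  "flip_gain (Branch l r) c (b # bs) =
     (if b then least_value (Branch l r) (map Not (b # bs)) - c else 0) + flip_gain (if b then r else l) c bs"
| "flip_gain t c bs = 0"

text \<open>
  The distance by which the leading one moves when it is flipped, for p the bits after it. If p
  consists of ones only, this is the distance known from p.
\<close>
definition jump :: "bool list \<Rightarrow> nat" where
  "jump p = Suc (length (takeWhile id p))"

text \<open>
  A lower bound for the drift of S times the position of the leading one, with that position
  moving by jump p, plus the value of the tree, as far as it can be derived from the context p.
\<close>
definition context_gain :: "int \<Rightarrow> context_tree \<Rightarrow> bool list \<Rightarrow> int" where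
  "context_gain S t p = S * int (jump p) + least_value t (map Not (drop (jump p) p)) - least_value t p + flip_gain t (least_value t p) p"

lemma least_value_append_le: "least_value t bs \<le> least_value t (bs @ cs)"
proof (induction t bs arbitrary: cs rule: least_value.induct)
  case (2 l r)
  have *: "min (least_value l []) (least_value r []) \<le> least_value (if b then r else l) []" for b by simp
  show ?case
  proof (cases cs)
    case (Cons b cs')
    have "least_value (if b then r else l) [] \<le> least_value (if b then r else l) cs'"
      using 2[of cs'] by simp
    then show ?thesis using *[of b] Cons by simp
  qed simp
qed simp_all

definition every_context :: "(bool list \<Rightarrow> bool) \<Rightarrow> context_tree \<Rightarrow> bool" where
  "every_context P t = list_all P (contexts t)"

lemma context_of_in_contexts:
  "depth t \<le> length bs \<Longrightarrow> context_of t bs \<in> set (contexts t)"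
proof (induction t arbitrary: bs)
  case (Branch l r)
  then show ?case by (cases bs) auto
qed simp

lemma context_of_prefix: "\<exists>rest. bs = context_of t bs @ rest"
proof (induction t arbitrary: bs)
  case (Branch l r)
  then show ?case by (cases bs) auto
qed simp

lemma least_value_context: "depth t \<le> length bs \<Longrightarrow> least_value t (context_of t bs @ cs) = least_value t bs"
proof (induction t arbitrary: bs)
  case (Branch l r)
  then show ?case by (cases bs) auto
qed simp

text \<open>
  Descending in the tree along the bits, a flip below the current bit acts in the subtree, and the
  flip at the current bit leaves a known prefix followed by unknown bits.
\<close>
lemma flip_gain_le:
  assumes "depth t \<le> length bs"
  shows "flip_gain t c (context_of t bs) \<le>
    (\<Sum>k<length (context_of t bs). if bs ! k then least_value t (km_flip k bs) - c else 0)"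
  using assms
proof (induction t arbitrary: bs)
  case (Branch l r)
  obtain b bs' where bs: "bs = b # bs'" using Branch.prems by (cases bs) auto
  let ?t = "if b then r else l"
  have h: "depth ?t \<le> length bs'" using Branch.prems bs by auto
  obtain rest where rest: "bs' = context_of ?t bs' @ rest" using context_of_prefix by blast
  have "least_value (Branch l r) (map Not (b # context_of ?t bs')) \<le> least_value (Branch l r) (map Not (b # context_of ?t bs') @ map Not rest)"
    by (rule least_value_append_le)
  also have "map Not (b # context_of ?t bs') @ map Not rest = map Not (b # (context_of ?t bs' @ rest))"
    by simp
  also have "\<dots> = km_flip 0 (b # bs')"
    using rest by (simp add: km_flip_def)
  finally have first: "least_value (Branch l r) (map Not (b # context_of ?t bs')) \<le> least_value (Branch l r) (km_flip 0 (b # bs'))" .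
  have later: "least_value (Branch l r) (km_flip (Suc k) (b # bs')) = least_value ?t (km_flip k bs')" for k
    by (simp add: km_flip_def)
  have "flip_gain ?t c (context_of ?t bs') \<le>
      (\<Sum>k<length (context_of ?t bs'). if bs' ! k then least_value ?t (km_flip k bs') - c else 0)"
    using Branch.IH h by (cases b) auto
  moreover have "flip_gain (Branch l r) c (context_of (Branch l r) (b # bs')) =
      (if b then least_value (Branch l r) (map Not (b # context_of ?t bs')) - c else 0) + flip_gain ?t c (context_of ?t bs')"
    by (simp del: least_value.simps)
  moreover have "(\<Sum>k<length (context_of (Branch l r) (b # bs')). if (b # bs') ! k then least_value (Branch l r) (km_flip k (b # bs')) - c else 0) =
      (if b then least_value (Branch l r) (km_flip 0 (b # bs')) - c else 0) +
      (\<Sum>k<length (context_of ?t bs'). if bs' ! k then least_value ?t (km_flip k bs') - c else 0)"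
    unfolding context_of.simps list.size add_Suc_right add_0_right sum.lessThan_Suc_shift nth_Cons_0 nth_Cons_Suc later ..
  ultimately show ?case unfolding bs using first by (cases b) (simp_all del: least_value.simps)
qed simp

definition window :: "bool list \<Rightarrow> bool list" where
  "window z = drop (Suc (lead z)) z"

definition context_value :: "context_tree \<Rightarrow> bool list \<Rightarrow> int" where
  "context_value t z = least_value t (window z)"

lemma lead_decomposition:
  assumes "lead z < length z"
  shows "z = replicate (lead z) False @ True # window z"
proof -
  have "z = take (lead z) z @ z ! lead z # drop (Suc (lead z)) z"
    using assms by (rule id_take_nth_drop)
  moreover have "take (lead z) z = replicate (lead z) False"
    using nth_less_lead[of _ z] lead_le[of z] by (auto simp: list_eq_iff_nth_eq)
  ultimately show ?thesis using nth_lead[OF assms] by (simp add: window_def)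
qed

lemma lead_Cons_True [simp]: "lead (True # bs) = 0"
  by (simp add: lead_def)

lemma lead_replicate_True: "lead (replicate m False @ True # bs) = m"
  by (simp add: lead_def takeWhile_append)

lemma window_replicate_True: "window (replicate m False @ True # bs) = bs"
  by (simp add: window_def lead_replicate_True)

lemma lead_replicate_append: "lead (replicate m False @ bs) = m + lead bs"
  by (simp add: lead_def takeWhile_append)

lemma window_replicate_append: "window (replicate m False @ bs) = window bs"
  by (simp add: window_def lead_replicate_append)

lemma sum_lessThan_add: "(\<Sum>s<m + k. h s) = (\<Sum>s<m. h s) + (\<Sum>i<k. h (m + i))" for h :: "nat \<Rightarrow> real"
  by (induction k) auto

text \<open>
  The flip at the leading one shifts the window; the other flips take place inside it.
\<close>
lemma km_gen_lead:
  "km_gen f (replicate m False @ True # bs) =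
     f (replicate (Suc m) False @ map Not bs) - f (replicate m False @ True # bs) +
     (\<Sum>k<length bs. if bs ! k then f (replicate m False @ True # km_flip k bs) - f (replicate m False @ True # bs) else 0)"
proof -
  let ?z = "replicate m False @ True # bs"
  let ?h = "\<lambda>s. if ?z ! s then f (km_flip s ?z) - f ?z else 0"
  have "km_gen f ?z = (\<Sum>s<m + Suc (length bs). ?h s)"
    unfolding km_gen_alt by simp
  also have "\<dots> = (\<Sum>s<m. ?h s) + (\<Sum>k<Suc (length bs). ?h (m + k))"
    by (rule sum_lessThan_add)
  also have "(\<Sum>s<m. ?h s) = 0" by (intro sum.neutral) (auto simp: nth_append)
  also have "(\<Sum>k<Suc (length bs). ?h (m + k)) = ?h m + (\<Sum>k<length bs. ?h (m + Suc k))"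
    by (subst sum.lessThan_Suc_shift) simp
  finally have "km_gen f ?z = ?h m + (\<Sum>k<length bs. ?h (m + Suc k))" by simp
  moreover have "km_flip (m + Suc k) ?z = replicate m False @ True # km_flip k bs" for k
    by (simp add: km_flip_def)
  moreover have "km_flip m ?z = replicate (Suc m) False @ map Not bs"
    by (simp add: km_flip_def replicate_append_same[symmetric])
  ultimately show ?thesis by (simp add: nth_append del: replicate_Suc cong: if_cong)
qed

lemma lead_False_run: "lead (map Not bs) = length (takeWhile id bs)"
  by (induction bs) (auto simp: lead_def)

lemma takeWhile_append_stop: "length (takeWhile P p) < length p \<Longrightarrow> takeWhile P (p @ r) = takeWhile P p"
  by (induction p) auto

lemma km_gen_lead_length:
  "km_gen (\<lambda>z. real (lead z)) (replicate m False @ True # bs) = real (jump bs)"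
  unfolding km_gen_lead
  by (simp add: lead_replicate_append lead_False_run jump_def del: replicate_Suc cong: if_cong)

lemma window_flip_lead:
  "window (replicate (Suc m) False @ map Not bs) = map Not (drop (jump bs) bs)"
  unfolding window_replicate_append by (simp add: window_def lead_False_run jump_def drop_map)

lemma least_value_nil_le: "least_value t [] \<le> least_value t bs"
  using least_value_append_le[of t "[]" bs] by simp

text \<open>
  If p contains a zero, the leading one stops inside p and the rest of p is still known
  afterwards. Otherwise nothing is known about the new window.
\<close>
lemma least_value_after_lead_flip:
  "least_value t (map Not (drop (jump p) p)) \<le> least_value t (map Not (drop (jump (p @ r)) (p @ r)))"
proof (cases "length (takeWhile id p) < length p")
  case True
  then have "map Not (drop (jump (p @ r)) (p @ r)) = map Not (drop (jump p) p) @ map Not r"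
    by (simp add: jump_def takeWhile_append_stop)
  then show ?thesis by (simp add: least_value_append_le)
next
  case False
  then have "drop (jump p) p = []" by (simp add: jump_def)
  then show ?thesis by (simp add: least_value_nil_le)
qed

lemma jump_context_le: "jump p \<le> jump (p @ r)"
  by (induction p) (auto simp: jump_def)

lemma jump_context_eq: "False \<in> set p \<Longrightarrow> jump (p @ r) = jump p"
  by (induction p) (auto simp: jump_def)

text \<open>
  Flips behind the context leave the context, hence the value, unchanged.
\<close>
lemma context_gain_le:
  fixes bs m t
  defines "p \<equiv> context_of t bs"
  assumes h: "depth t \<le> length bs"
  shows "real_of_int (context_gain S t p - S * int (jump p)) \<le>
     km_gen (\<lambda>z. real_of_int (context_value t z)) (replicate m False @ True # bs)"
proof -
  obtain r where r: "bs = p @ r" using context_of_prefix unfolding p_def by blast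
  have least_value_p: "least_value t p = least_value t bs" using least_value_context[OF h, of "[]"] by (simp add: p_def)
  have "flip_gain t (least_value t p) p \<le> (\<Sum>k<length p. if bs ! k then least_value t (km_flip k bs) - least_value t p else 0)"
    unfolding p_def by (rule flip_gain_le[OF h])
  also have "\<dots> = (\<Sum>k<length bs. if bs ! k then least_value t (km_flip k bs) - least_value t bs else 0)"
  proof (rule sum.mono_neutral_cong_left)
    show "\<forall>k\<in>{..<length bs} - {..<length p}. (if bs ! k then least_value t (km_flip k bs) - least_value t bs else 0) = 0"
    proof
      fix k assume "k \<in> {..<length bs} - {..<length p}"
      then have "take (length p) (km_flip k bs) = p"
        by (simp add: take_km_flip) (simp add: r)
      then have "km_flip k bs = p @ drop (length p) (km_flip k bs)"
        by (metis append_take_drop_id)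
      then have "least_value t (km_flip k bs) = least_value t bs"
        unfolding p_def using least_value_context[OF h] by metis
      then show "(if bs ! k then least_value t (km_flip k bs) - least_value t bs else 0) = 0" by simp
    qed
  qed (auto simp: r least_value_p[unfolded r])
  finally have flips: "flip_gain t (least_value t p) p \<le> (\<Sum>k<length bs. if bs ! k then least_value t (km_flip k bs) - least_value t bs else 0)" .
  have "context_gain S t p - S * int (jump p) =
      least_value t (map Not (drop (jump p) p)) - least_value t p + flip_gain t (least_value t p) p"
    by (simp add: context_gain_def)
  also have "\<dots> \<le> least_value t (map Not (drop (jump bs) bs)) - least_value t bs +
      (\<Sum>k<length bs. if bs ! k then least_value t (km_flip k bs) - least_value t bs else 0)"
    using least_value_after_lead_flip[of t p r] flips least_value_p by (simp add: r)
  finally have "real_of_int (context_gain S t p - S * int (jump p)) \<le>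
      real_of_int (least_value t (map Not (drop (jump bs) bs)) - least_value t bs +
      (\<Sum>k<length bs. if bs ! k then least_value t (km_flip k bs) - least_value t bs else 0))"
    by (simp only: of_int_le_iff)
  also have "\<dots> = km_gen (\<lambda>z. real_of_int (context_value t z)) (replicate m False @ True # bs)"
    unfolding km_gen_lead
    by (simp add: context_value_def window_flip_lead window_replicate_True if_distrib[of real_of_int]
        del: replicate_Suc cong: if_cong)
  finally show ?thesis .
qed

text \<open>
  The two signs of S serve the two directions: jump of the context is at most the true jump, so
  for nonnegative S the correction may be dropped.
\<close>
lemma context_gain_drift:
  assumes "depth t \<le> length bs"
  shows "real_of_int (context_gain S t (context_of t bs)) +
      real_of_int S * (real (jump bs) - real (jump (context_of t bs))) \<le>
    km_gen (\<lambda>z. real_of_int S * real (lead z) + real_of_int (context_value t z)) (replicate m False @ True # bs)"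
  using context_gain_le[OF assms, of S m]
  by (simp add: km_gen_add km_gen_cmult km_gen_lead_length algebra_simps)

lemma every_contextD: "every_context P t \<Longrightarrow> depth t \<le> length bs \<Longrightarrow> P (context_of t bs)"
  using context_of_in_contexts[of t bs] by (auto simp: every_context_def list_all_iff)

lemma length_window: "lead z < length z \<Longrightarrow> Suc (lead z + length (window z)) = length z"
  by (simp add: window_def)

lemma least_value_bounded: "\<exists>M. \<forall>bs. \<bar>least_value t bs\<bar> \<le> M"
proof (induction t)
  case (Leaf c)
  show ?case by (intro exI[of _ "\<bar>c\<bar>"]) simp
next
  case (Branch l r)
  then obtain A B where A: "\<And>bs. \<bar>least_value l bs\<bar> \<le> A" and B: "\<And>bs. \<bar>least_value r bs\<bar> \<le> B" by blast
  have "\<bar>least_value (Branch l r) bs\<bar> \<le> max A B" for bs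
  proof (cases bs)
    case Nil
    then show ?thesis using A[of "[]"] B[of "[]"] by (simp add: min_def max_def)
  next
    case (Cons b bs')
    then show ?thesis using A[of bs'] B[of bs'] by (simp add: le_max_iff_disj)
  qed
  then show ?case by blast
qed

text \<open>
  A context with a zero determines the jump, and one without is so long that its jump is at least
  32, the truncation level.
\<close>
lemma jump_context_truncated:
  assumes "list_ex Not p \<or> 32 \<le> jump p"
  shows "real (jump (p @ r)) \<le> real (jump p) + real (jump (p @ r) - 32)"
proof (cases "list_ex Not p")
  case True
  then have "False \<in> set p" by (auto simp: list_ex_iff)
  then show ?thesis by (simp add: jump_context_eq)
next
  case False
  then show ?thesis using assms by auto
qed


section \<open>A potential for long first runs\<close>

text \<open>
  The excess over 32 raises the target of the leading part by 1 for every unit of R. With slope a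
  / m beyond 32, the terms generated by the splitting of the first run contribute at most a / 10
  more (split_sum_diff_le), and a = 10/9 solves 1 + a / 10 = a.
\<close>
definition tail_slope :: "nat \<Rightarrow> real" where
  "tail_slope m = (if 32 < m then 10 / 9 / real m else 0)"

definition tail_log :: "nat \<Rightarrow> real" where
  "tail_log Z = (\<Sum>m=1..Z. tail_slope m)"

text \<open>
  Chosen such that (r + m) times the weight is exactly what the m-th one of the second run of ones
  adds to the drift of the term tail_log Z / R (trailing_weight_sum).
\<close>
definition trailing_weight :: "nat \<Rightarrow> nat \<Rightarrow> nat \<Rightarrow> real" where
  "trailing_weight r s m = (tail_slope m / real s + tail_slope (s + m) / real r) / real (r + m)"

definition trailing_part :: "nat \<Rightarrow> nat \<Rightarrow> nat \<Rightarrow> real" where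
  "trailing_part r s k = (\<Sum>m=1..k. trailing_weight r s m)"

text \<open>
  This is a (1 + harm 33) / 33 for the slope a = 10/9, the supremum of the bound for the trailing
  part over r, s of at least 1 (trailing_part_le).
\<close>
definition tail_const :: real where
  "tail_const = 10 / 297 * (1 + harm 33)"

definition split_sum :: "nat \<Rightarrow> real" where
  "split_sum R = (\<Sum>j=1..<R. tail_log (R - j) / real j)"

text \<open>
  What the leading part has to compensate: the excess over 32, the creation of zeros of length R -
  j by a split of the first run at j, and the trailing parts created by these splits.
\<close>
definition leading_target :: "nat \<Rightarrow> real" where
  "leading_target R = real (R - 32) + split_sum R + tail_const * harm (R - 1)"

text \<open>
  The solution of the recursion in leading_part_balance.
\<close>
definition leading_part :: "nat \<Rightarrow> real" where
  "leading_part R = (\<Sum>m=2..R. (leading_target m - leading_target (m - 1)) / real m)"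

text \<open>
  R ones followed by Z zeros, k ones and further bits. The middle term prepares for the moment
  when the leading one is flipped and the Z zeros become the first run of ones.
\<close>
definition run_potential :: "nat \<Rightarrow> nat \<Rightarrow> nat \<Rightarrow> real" where
  "run_potential R Z k = leading_part R + tail_log Z / real R + trailing_part R Z k"

lemma tail_slope_nonneg: "0 \<le> tail_slope m"
  by (simp add: tail_slope_def)

lemma tail_log_0 [simp]: "tail_log 0 = 0"
  by (simp add: tail_log_def)

lemma tail_log_Suc: "tail_log (Suc Z) = tail_log Z + tail_slope (Suc Z)"
  by (simp add: tail_log_def)

lemma tail_log_nonneg: "0 \<le> tail_log Z"
  by (simp add: tail_log_def sum_nonneg tail_slope_nonneg)

lemma trailing_part_0 [simp]: "trailing_part r s 0 = 0"
  by (simp add: trailing_part_def)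

lemma trailing_weight_nonneg: "0 \<le> trailing_weight r s m"
  by (simp add: trailing_weight_def tail_slope_nonneg)

lemma trailing_part_nonneg: "0 \<le> trailing_part r s k"
  by (simp add: trailing_part_def sum_nonneg trailing_weight_nonneg)

lemma tail_const_nonneg: "0 \<le> tail_const"
  by (simp add: tail_const_def harm_nonneg)

lemma leading_part_small [simp]: "leading_part 0 = 0" "leading_part (Suc 0) = 0"
  by (simp_all add: leading_part_def)

lemma leading_part_Suc:
  "1 \<le> R \<Longrightarrow> leading_part (Suc R) = leading_part R + (leading_target (Suc R) - leading_target R) / real (Suc R)"
  by (simp add: leading_part_def)

text \<open>
  The left-hand side is minus the drift of the leading part under the flips of the first run other
  than the leading one, together with the loss when the leading one is flipped.
\<close>
lemma leading_part_balance:
  "1 \<le> R \<Longrightarrow> real R * leading_part R - (\<Sum>j=1..<R. leading_part j) = leading_target R"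
proof (induction R rule: dec_induct)
  case base
  show ?case by (simp add: leading_target_def split_sum_def harm_def)
next
  case (step R)
  have "real (Suc R) * leading_part (Suc R) = real (Suc R) * leading_part R + (leading_target (Suc R) - leading_target R)"
    using step by (simp add: leading_part_Suc field_simps)
  then show ?case using step by (simp add: algebra_simps)
qed

text \<open>
  The left-hand side is minus the drift of the trailing part under the rings of both runs of ones,
  except for the values after a flip in the first run and at the start of the second.
\<close>
lemma trailing_part_balance:
  "real R * trailing_part R Z k + (\<Sum>j<k. trailing_part R Z k - trailing_part R Z j) =
    (\<Sum>m=1..k. real (R + m) * trailing_weight R Z m)"
proof (induction k)
  case (Suc k)
  let ?q = "trailing_weight R Z (Suc k)"
  have eq: "trailing_part R Z (Suc k) = trailing_part R Z k + ?q" by (simp add: trailing_part_def)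
  have "(\<Sum>j<Suc k. trailing_part R Z (Suc k) - trailing_part R Z j) =
      (\<Sum>j<k. trailing_part R Z k - trailing_part R Z j) + real (Suc k) * ?q"
    unfolding eq by (simp add: sum.distrib algebra_simps sum_subtractf)
  then show ?case using Suc by (simp add: eq algebra_simps)
qed simp

lemma trailing_weight_sum:
  assumes "1 \<le> R"
  shows "(\<Sum>m=1..k. real (R + m) * trailing_weight R Z m) =
    tail_log k / real Z + (tail_log (Z + k) - tail_log Z) / real R"
proof -
  have "(\<Sum>m=1..k. real (R + m) * trailing_weight R Z m) =
      (\<Sum>m=1..k. tail_slope m / real Z + tail_slope (Z + m) / real R)"
    using assms by (intro sum.cong) (auto simp: trailing_weight_def)
  also have "\<dots> = tail_log k / real Z + (\<Sum>m=1..k. tail_slope (Z + m)) / real R"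
    by (simp add: sum.distrib tail_log_def sum_divide_distrib)
  also have "(\<Sum>m=1..k. tail_slope (Z + m)) = tail_log (Z + k) - tail_log Z"
    by (induction k) (auto simp: tail_log_Suc)
  finally show ?thesis .
qed

text \<open>
  Up to m = 32 the sum is a partial harmonic sum divided by 33, and beyond that it telescopes to
  at most 1/33.
\<close>
lemma sum_capped_inverse_squares_le:
  "(\<Sum>m=1..k. 1 / (real (max 33 (m + 1)) * real (m + 1))) \<le> harm 33 / 33"
proof -
  let ?g = "\<lambda>m. 1 / (real (max 33 (m + 1)) * real (m + 1))"
  have base: "(\<Sum>m=1..32. ?g m) = harm 33 / 33 - 1 / 33"
  proof -
    have "(\<Sum>m=1..32. ?g m) = (\<Sum>m=1..32. 1 / real (m + 1)) / 33"
      unfolding sum_divide_distrib by (intro sum.cong) auto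
    also have "(\<Sum>m=1..32::nat. 1 / real (m + 1)) = (\<Sum>m=2..33. 1 / real m)"
      by (rule sum.reindex_bij_witness[of _ "\<lambda>m. m - 1" Suc]) auto
    also have "\<dots> = harm 33 - 1"
    proof -
      have "harm 33 = (\<Sum>m=1..33. 1 / real m)" by (simp add: harm_def inverse_eq_divide)
      also have "\<dots> = 1 / real 1 + (\<Sum>m=Suc 1..33. 1 / real m)" by (rule sum.atLeast_Suc_atMost) simp
      finally show ?thesis by (simp add: numeral_2_eq_2)
    qed
    finally show ?thesis by simp
  qed
  have large: "(\<Sum>m=1..k. ?g m) \<le> harm 33 / 33 - 1 / real (k + 1)" if "32 \<le> k" for k
    using that
  proof (induction k rule: dec_induct)
    case base
    then show ?case using \<open>(\<Sum>m=1..32. ?g m) = harm 33 / 33 - 1 / 33\<close> by simp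
  next
    case (step k)
    have "?g (Suc k) \<le> 1 / real (k + 1) - 1 / real (Suc k + 1)"
      using step(1) by (simp add: max_def divide_simps)
    then show ?case using step by simp
  qed
  show ?thesis
  proof (cases "32 \<le> k")
    case True
    then show ?thesis using large[OF True] by (smt (verit) divide_nonneg_nonneg of_nat_0_le_iff)
  next
    case False
    then have "(\<Sum>m=1..k. ?g m) \<le> (\<Sum>m=1..32. ?g m)"
      by (intro sum_mono2) auto
    then show ?thesis using base by simp
  qed
qed

lemma sum_tail_slope_le:
  "(\<Sum>m=1..k. tail_slope m / real (m + 1)) \<le> 10 / 297"
proof -
  have "(\<Sum>m=1..k. tail_slope m / real (m + 1)) \<le> 10 / 9 * (1 / 33 - (if 33 \<le> k then 1 / real (k + 1) else 1 / 33))"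
  proof (induction k)
    case (Suc k)
    have "1 / real (Suc k) - 1 / real (Suc k + 1) = 1 / (real (Suc k) * real (Suc k + 1))"
      by (simp add: field_simps)
    then have "tail_slope (Suc k) / real (Suc k + 1) =
        (if 32 \<le> k then 10 / 9 * (1 / real (Suc k) - 1 / real (Suc k + 1)) else 0)"
      by (simp add: tail_slope_def)
    note slope = this
    show ?case
    proof (cases "32 \<le> k")
      case True
      have "(\<Sum>m=1..k. tail_slope m / real (m + 1)) \<le> 10 / 9 * (1 / 33 - 1 / real (Suc k))"
        using Suc True by (cases "k = 32") auto
      then have "(\<Sum>m=1..Suc k. tail_slope m / real (m + 1)) \<le>
          10 / 9 * (1 / 33 - 1 / real (Suc k)) + 10 / 9 * (1 / real (Suc k) - 1 / real (Suc k + 1))"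
        unfolding slope[unfolded if_P[OF True], symmetric] by (simp only: sum.cl_ivl_Suc) simp
      also have "\<dots> = 10 / 9 * (1 / 33 - 1 / real (Suc k + 1))"
        by (simp only: distrib_left[symmetric]) simp
      finally show ?thesis using True by simp
    next
      case False
      then show ?thesis using Suc slope by auto
    qed
  qed simp
  also have "\<dots> \<le> 10 / 297" by auto
  finally show ?thesis .
qed

text \<open>
  Use r + m at least m + 1 in both summands of the weight, and s + m at least m + 1 in the second.
\<close>
lemma trailing_part_le:
  assumes "1 \<le> r" "1 \<le> s"
  shows "trailing_part r s k \<le> 10 / 297 * (1 / real s + harm 33 / real r)"
proof -
  have w: "trailing_weight r s m \<le> tail_slope m / real (m + 1) / real s +
      10 / 9 * (1 / (real (max 33 (m + 1)) * real (m + 1))) / real r" if "1 \<le> m" for m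
  proof -
    have "tail_slope m / real s / real (r + m) \<le> tail_slope m / real s / real (m + 1)"
      using assms by (intro divide_left_mono) (auto simp: tail_slope_nonneg)
    moreover have "tail_slope (s + m) / real r / real (r + m) \<le>
        10 / 9 * (1 / (real (max 33 (m + 1)) * real (m + 1))) / real r"
    proof -
      have "tail_slope (s + m) \<le> 10 / 9 * (1 / real (max 33 (m + 1)))"
        using assms by (auto simp: tail_slope_def max_def divide_simps)
      then have "tail_slope (s + m) / real (r + m) \<le> 10 / 9 * (1 / real (max 33 (m + 1))) / real (m + 1)"
        using assms by (intro frac_le) (auto simp: tail_slope_nonneg)
      then have "tail_slope (s + m) / real (r + m) / real r \<le> 10 / 9 * (1 / real (max 33 (m + 1))) / real (m + 1) / real r"
        by (rule divide_right_mono) simp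
      then show ?thesis by (simp add: field_simps)
    qed
    ultimately show ?thesis
      by (simp add: trailing_weight_def add_divide_distrib field_simps)
  qed
  have "trailing_part r s k \<le> (\<Sum>m=1..k. tail_slope m / real (m + 1) / real s +
      10 / 9 * (1 / (real (max 33 (m + 1)) * real (m + 1))) / real r)"
    unfolding trailing_part_def by (intro sum_mono w) simp
  also have "\<dots> = (\<Sum>m=1..k. tail_slope m / real (m + 1)) / real s +
      10 / 9 * (\<Sum>m=1..k. 1 / (real (max 33 (m + 1)) * real (m + 1))) / real r"
    by (simp add: sum.distrib sum_divide_distrib sum_distrib_left)
  also have "\<dots> \<le> 10 / 297 / real s + 10 / 9 * (harm 33 / 33) / real r"
    by (intro add_mono divide_right_mono mult_left_mono sum_tail_slope_le sum_capped_inverse_squares_le) auto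
  finally show ?thesis by (simp add: field_simps)
qed

lemma trailing_part_le_const: "1 \<le> r \<Longrightarrow> 1 \<le> s \<Longrightarrow> trailing_part r s k \<le> tail_const"
proof -
  assume rs: "1 \<le> r" "1 \<le> s"
  have "trailing_part r s k \<le> 10 / 297 * (1 / real s + harm 33 / real r)" by (rule trailing_part_le[OF rs])
  also have "\<dots> \<le> 10 / 297 * (1 / 1 + harm 33 / 1)"
    using rs by (intro mult_left_mono add_mono divide_left_mono) (auto simp: harm_nonneg)
  finally show ?thesis by (simp add: tail_const_def)
qed

lemma sum_trailing_part_le:
  "(\<Sum>j=1..<R. trailing_part j (R - j) Z) \<le> tail_const * harm (R - 1)"
proof -
  have "(\<Sum>j=1..<R. trailing_part j (R - j) Z) \<le> (\<Sum>j=1..<R. 10 / 297 * (1 / real (R - j) + harm 33 / real j))"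
    by (intro sum_mono trailing_part_le) auto
  also have "\<dots> = 10 / 297 * ((\<Sum>j=1..<R. 1 / real (R - j)) + harm 33 * (\<Sum>j=1..<R. 1 / real j))"
    unfolding sum_distrib_left[symmetric] sum.distrib
    by (simp add: sum_distrib_left[of "harm 33"])
  also have "(\<Sum>j=1..<R. 1 / real (R - j)) = (\<Sum>j=1..<R. 1 / real j)"
    by (rule sum.reindex_bij_witness[of _ "\<lambda>j. R - j" "\<lambda>j. R - j"]) auto
  also have "(\<Sum>j=1..<R. 1 / real j) = harm (R - 1)"
    by (cases R) (auto simp: harm_def inverse_eq_divide atLeastLessThanSuc_atLeastAtMost)
  finally show ?thesis by (simp add: tail_const_def algebra_simps)
qed

text \<open>
  The chord of slope 1/16, touching at 15 and 16, bounds the concave function harm from above.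
\<close>
lemma harm_le_line: "harm p \<le> harm 15 + (real p - 15) / (16 :: real)"
proof (cases "15 \<le> p")
  case True
  then show ?thesis
  proof (induction p rule: dec_induct)
    case (step p)
    then have "inverse (real (Suc p)) \<le> 1 / 16" by (simp add: field_simps)
    then show ?case using step by (simp add: harm_Suc add_divide_distrib diff_divide_distrib)
  qed simp
next
  case False
  then have "p \<le> 15" by simp
  then show ?thesis
  proof (induction p rule: inc_induct)
    case (step p)
    then have "1 / 16 \<le> inverse (real (Suc p))" by (simp add: field_simps)
    then show ?case using step by (simp add: harm_Suc add_divide_distrib diff_divide_distrib)
  qed simp
qed

lemma split_sum_diff:
  assumes "1 \<le> R"
  shows "split_sum (Suc R) - split_sum R = (\<Sum>j=1..R. tail_slope (Suc R - j) / real j)"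
proof -
  have "split_sum R = (\<Sum>j=1..R. tail_log (R - j) / real j)"
    using assms unfolding split_sum_def by (intro sum.mono_neutral_left) auto
  moreover have "split_sum (Suc R) = (\<Sum>j=1..R. tail_log (Suc R - j) / real j)"
    by (simp add: split_sum_def atLeastLessThanSuc_atLeastAtMost)
  moreover have "tail_log (Suc R - j) - tail_log (R - j) = tail_slope (Suc R - j)" if "j \<in> {1..R}" for j
    using that by (simp add: Suc_diff_le tail_log_Suc)
  ultimately show ?thesis
    by (simp add: sum_subtractf[symmetric] diff_divide_distrib[symmetric])
qed

text \<open>
  By partial fractions the increment is a / (R + 1) times a sum of 1 / j + 1 / (R + 1 - j), in
  which the second denominator is at least 33. A linear bound for the harmonic numbers turns this
  into a / 10.
\<close>
lemma split_sum_diff_le: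
  assumes "1 \<le> R"
  shows "split_sum (Suc R) - split_sum R \<le> (if 32 \<le> R then 1 / 9 else 0)"
proof (cases "33 \<le> R")
  case False
  then have "(\<Sum>j=1..R. tail_slope (Suc R - j) / real j) \<le> 0"
    by (intro sum_nonpos) (auto simp: tail_slope_def)
  then show ?thesis unfolding split_sum_diff[OF assms] by auto
next
  case True
  define p where "p = R - 32"
  have R: "R = p + 32" "1 \<le> p" using True by (auto simp: p_def)
  have "(\<Sum>j=1..R. tail_slope (Suc R - j) / real j) = (\<Sum>j=1..p. tail_slope (Suc R - j) / real j)"
    using R by (intro sum.mono_neutral_right) (auto simp: tail_slope_def)
  also have "\<dots> = (\<Sum>j=1..p. 10 / 9 / real (R + 1) * (1 / real j + 1 / real (Suc R - j)))"
  proof (intro sum.cong refl)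
    fix j assume "j \<in> {1..p}"
    then have j: "1 \<le> j" "j \<le> p" by auto
    then have r: "real (Suc R - j) = real R + 1 - real j" "0 < real R + 1 - real j" using R by auto
    show "tail_slope (Suc R - j) / real j = 10 / 9 / real (R + 1) * (1 / real j + 1 / real (Suc R - j))"
    proof -
      have "1 / real j + 1 / (real R + 1 - real j) = (real R + 1) / (real j * (real R + 1 - real j))"
        using j r by (simp add: field_simps)
      moreover have "32 < Suc R - j" using j R by simp
      moreover have "10 / 9 / D / x = 10 / 9 / N * (N / (x * D))" if "N \<noteq> 0" for D x N :: real
        using that by (simp add: mult.commute)
      moreover have "real (R + 1) = real R + 1" "real R + 1 \<noteq> 0" by simp_all
      ultimately show ?thesis unfolding tail_slope_def r(1) by (simp only: if_True)
    qed
  qed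
  also have "\<dots> \<le> (\<Sum>j=1..p. 10 / 9 / real (R + 1) * (1 / real j + 1 / 33))"
    using R by (intro sum_mono mult_left_mono add_mono divide_left_mono) auto
  also have "\<dots> = 10 / 9 / real (R + 1) * (harm p + real p / 33)"
    unfolding sum_distrib_left[symmetric] sum.distrib by (simp add: harm_def inverse_eq_divide)
  also have "\<dots> \<le> 10 / 9 / real (R + 1) * (real (R + 1) / 10)"
  proof (intro mult_left_mono)
    have "harm 15 \<le> (10 / 3 :: real)" by (simp add: harm_expand)
    moreover have "real (R + 1) = real p + 33" "1 \<le> real p" using R by simp_all
    moreover have "k + q / 33 \<le> (q + 33) / 10" if "h \<le> 10 / 3" "k \<le> h + (q - 15) / 16" "1 \<le> q"
      for h k q :: real
      using that by argo
    ultimately show "harm p + real p / 33 \<le> real (R + 1) / 10"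
      using harm_le_line[of p] by metis
  qed simp
  also have "\<dots> = 1 / 9" by simp
  finally show ?thesis using True unfolding split_sum_diff[OF assms] by simp
qed

lemma split_sum_mono: "1 \<le> R \<Longrightarrow> split_sum R \<le> split_sum (Suc R)"
  using split_sum_diff[of R] sum_nonneg[of "{1..R}" "\<lambda>j. tail_slope (Suc R - j) / real j"]
  by (simp add: tail_slope_nonneg)

text \<open>
  The slope of tail_log and the telescoping sum with tail_const dominate the increments of the
  leading part.
\<close>
lemma leading_target_diff:
  assumes "1 \<le> R"
  shows "0 \<le> leading_target (Suc R) - leading_target R"
    and "(leading_target (Suc R) - leading_target R) / real (Suc R) \<le>
      tail_slope (Suc R) + tail_const * (1 / real R - 1 / real (Suc R))"
proof -
  have h: "harm R = harm (R - 1) + 1 / real R"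
    using assms by (cases R) (auto simp: harm_Suc inverse_eq_divide)
  have eq: "leading_target (Suc R) - leading_target R =
      (if 32 \<le> R then 1 else 0) + (split_sum (Suc R) - split_sum R) + tail_const / real R"
    by (auto simp: leading_target_def h algebra_simps Suc_diff_le)
  show "0 \<le> leading_target (Suc R) - leading_target R"
    unfolding eq using split_sum_mono[OF assms] tail_const_nonneg by auto
  have "(leading_target (Suc R) - leading_target R) / real (Suc R) \<le>
      ((if 32 \<le> R then 10 / 9 else 0) + tail_const / real R) / real (Suc R)"
    unfolding eq using split_sum_diff_le[OF assms] by (intro divide_right_mono) (auto split: if_splits)
  also have "\<dots> = tail_slope (Suc R) + tail_const * (1 / real R - 1 / real (Suc R))"
    using assms by (auto simp: tail_slope_def divide_simps)
  finally show "(leading_target (Suc R) - leading_target R) / real (Suc R) \<le>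
      tail_slope (Suc R) + tail_const * (1 / real R - 1 / real (Suc R))" .
qed

lemma leading_part_nonneg: "0 \<le> leading_part R"
proof (cases "1 \<le> R")
  case True
  then show ?thesis
  proof (induction R rule: dec_induct)
    case (step R)
    then show ?case unfolding leading_part_Suc[OF step(1)]
      by (intro add_nonneg_nonneg divide_nonneg_nonneg leading_target_diff(1)) auto
  qed simp
qed (simp add: not_le)

text \<open>
  This is why tail_log is the right prepayment: it covers the leading part of a run of the same
  length up to a constant.
\<close>
lemma leading_part_le: "leading_part Z \<le> tail_log Z + tail_const"
proof (cases "1 \<le> Z")
  case True
  then have "leading_part Z \<le> tail_log Z + tail_const * (1 - 1 / real Z)"
  proof (induction Z rule: dec_induct)
    case base
    show ?case by (simp add: tail_log_def tail_slope_def)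
  next
    case (step Z)
    then show ?case using leading_target_diff(2)[OF step(1)]
      by (simp add: leading_part_Suc tail_log_Suc algebra_simps)
  qed
  also have "\<dots> \<le> tail_log Z + tail_const"
    using tail_const_nonneg by (simp add: mult_left_le)
  finally show ?thesis .
qed (simp add: not_le tail_const_nonneg)

lemma run_potential_nonneg: "0 \<le> run_potential R Z k"
  by (simp add: run_potential_def leading_part_nonneg tail_log_nonneg trailing_part_nonneg)

text \<open>
  The five terms after the excess are the effects of flipping the leading one, an inner one of the
  first run, the first one of the second run (which merges two runs of zeros), and an inner one of
  the second run. Everything cancels exactly except for three terms, each at most tail_const.
\<close>
lemma run_potential_drift:
  assumes R: "1 \<le> R" and Z: "Z = 0 \<Longrightarrow> k = 0" and k: "k = 0 \<Longrightarrow> w = 0"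
  shows "real (R - 32) + (run_potential Z k w - run_potential R Z k) +
    (\<Sum>j=1..<R. run_potential j (R - j) Z - run_potential R Z k) +
    (if 1 \<le> k then run_potential R (Z + k) w - run_potential R Z k else 0) +
    (\<Sum>j=1..<k. run_potential R Z j - run_potential R Z k) \<le> 3 * tail_const"
    (is "?lhs \<le> _")
proof -
  let ?merge = "if 1 \<le> k then trailing_part R (Z + k) w else 0"
  have f: "leading_part Z - leading_part R + (\<Sum>j=1..<R. leading_part j - leading_part R) = leading_part Z - leading_target R"
    using leading_part_balance[OF R] R by (simp add: sum_subtractf algebra_simps of_nat_diff)
  have e: "tail_log k / real Z - tail_log Z / real R + (\<Sum>j=1..<R. tail_log (R - j) / real j - tail_log Z / real R) =
      tail_log k / real Z - tail_log Z + split_sum R"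
  proof -
    define c where "c = tail_log Z / real R"
    have "real R * c = tail_log Z" using R by (simp add: c_def)
    then show ?thesis
      unfolding c_def[symmetric] using R
      by (simp add: sum_subtractf split_sum_def of_nat_diff left_diff_distrib)
  qed
  have u: "(\<Sum>j=1..<k. trailing_part R Z j - trailing_part R Z k) + (if 1 \<le> k then - trailing_part R Z k else 0) =
      - (\<Sum>j<k. trailing_part R Z k - trailing_part R Z j)"
  proof (cases k)
    case (Suc i)
    have "(\<Sum>j<k. trailing_part R Z k - trailing_part R Z j) =
        trailing_part R Z k + (\<Sum>j=1..<k. trailing_part R Z k - trailing_part R Z j)"
      unfolding lessThan_atLeast0 using Suc by (subst sum.atLeast_Suc_lessThan) auto
    then show ?thesis using Suc by (simp add: sum_subtractf)
  qed simp
  have "?lhs = real (R - 32) +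
      (leading_part Z - leading_part R + (\<Sum>j=1..<R. leading_part j - leading_part R)) +
      (tail_log k / real Z - tail_log Z / real R + (\<Sum>j=1..<R. tail_log (R - j) / real j - tail_log Z / real R)) +
      (tail_log (Z + k) - tail_log Z) / real R +
      (trailing_part Z k w + (\<Sum>j=1..<R. trailing_part j (R - j) Z) + ?merge) - real R * trailing_part R Z k +
      ((\<Sum>j=1..<k. trailing_part R Z j - trailing_part R Z k) + (if 1 \<le> k then - trailing_part R Z k else 0))"
    using R by (cases "k = 0") (auto simp: run_potential_def sum.distrib sum_subtractf algebra_simps of_nat_diff diff_divide_distrib add_divide_distrib)
  also have "\<dots> = real (R - 32) + leading_part Z - leading_target R - tail_log Z + split_sum R +
      (trailing_part Z k w + (\<Sum>j=1..<R. trailing_part j (R - j) Z) + ?merge)"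
    unfolding f e u
    using trailing_part_balance[of R Z k] trailing_weight_sum[OF R, of Z k] by simp
  also have "\<dots> = (leading_part Z - tail_log Z) + trailing_part Z k w + ?merge +
      ((\<Sum>j=1..<R. trailing_part j (R - j) Z) - tail_const * harm (R - 1))"
    by (simp add: leading_target_def)
  also have "\<dots> \<le> tail_const + tail_const + tail_const + 0"
  proof (intro add_mono)
    show "leading_part Z - tail_log Z \<le> tail_const" using leading_part_le[of Z] by simp
    show "trailing_part Z k w \<le> tail_const"
    proof (cases "k = 0")
      case True
      then show ?thesis using k tail_const_nonneg by simp
    next
      case False
      then have "1 \<le> Z" "1 \<le> k" using Z by (cases Z; auto)+
      then show ?thesis by (intro trailing_part_le_const)
    qed
    show "?merge \<le> tail_const"
    proof (cases "1 \<le> k")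
      case True
      then show ?thesis using trailing_part_le_const[OF R, of "Z + k" w] by simp
    next
      case False
      then show ?thesis using tail_const_nonneg by simp
    qed
    show "(\<Sum>j=1..<R. trailing_part j (R - j) Z) - tail_const * harm (R - 1) \<le> 0"
      using sum_trailing_part_le[of R Z] by simp
  qed
  finally show ?thesis by simp
qed

lemma tail_const_le: "3 * tail_const \<le> 516 / 1000"
proof -
  have "harm 33 \<le> (41 / 10 :: real)" by (simp add: harm_expand)
  then show ?thesis by (simp add: tail_const_def)
qed


section \<open>Runs of a vertex and the drift of the tail potential\<close>

definition run_value :: "bool list \<Rightarrow> real" where
  "run_value z =
    (let a = dropWhile Not z; b = dropWhile id a; c = dropWhile Not b in
     run_potential (length (takeWhile id a)) (length (takeWhile Not b)) (length (takeWhile id c)))"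

lemma takeWhile_replicate_append:
  "(\<And>x. x \<in> set r \<Longrightarrow> P x) \<Longrightarrow> (s = [] \<or> \<not> P (hd s)) \<Longrightarrow> takeWhile P (r @ s) = r"
  by (cases s) (auto simp: takeWhile_append)

lemma dropWhile_replicate_append:
  "(\<And>x. x \<in> set r \<Longrightarrow> P x) \<Longrightarrow> (s = [] \<or> \<not> P (hd s)) \<Longrightarrow> dropWhile P (r @ s) = s"
  by (cases s) (auto simp: dropWhile_append)

text \<open>
  The conditions say that the listed runs are maximal, and that a run is empty only at the end of
  the list.
\<close>
lemma run_value_runs:
  assumes "R = 0 \<Longrightarrow> Z = 0" "Z = 0 \<Longrightarrow> k = 0" "k = 0 \<Longrightarrow> rest = []" "rest = [] \<or> \<not> hd rest"
  shows "run_value (replicate m False @ replicate R True @ replicate Z False @ replicate k True @ rest) =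
    run_potential R Z k"
proof -
  let ?c = "replicate k True @ rest"
  let ?b = "replicate Z False @ ?c"
  let ?a = "replicate R True @ ?b"
  have hd: "?a = [] \<or> hd ?a" "?b = [] \<or> \<not> hd ?b" "?c = [] \<or> hd ?c"
    using assms by (cases R; cases Z; cases k; simp)+
  have "dropWhile Not (replicate m False @ ?a) = ?a" "dropWhile id ?a = ?b" "dropWhile Not ?b = ?c"
    using hd by (intro dropWhile_replicate_append; auto)+
  moreover have "takeWhile id ?a = replicate R True" "takeWhile Not ?b = replicate Z False" "takeWhile id ?c = replicate k True"
    using hd assms(4) by (intro takeWhile_replicate_append; auto)+
  ultimately show ?thesis by (simp add: run_value_def)
qed

lemma run_value_nonneg: "0 \<le> run_value z"
  by (simp add: run_value_def Let_def run_potential_nonneg)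

lemma takeWhile_runs:
  "takeWhile id xs = replicate (length (takeWhile id xs)) True"
  "takeWhile Not xs = replicate (length (takeWhile Not xs)) False"
  by (induction xs) auto

lemma run_decomposition:
  obtains R Z k w tail where
    "True # bs = replicate R True @ replicate Z False @ replicate k True @ replicate w False @ tail"
    "1 \<le> R" "R = jump bs" "Z = 0 \<longrightarrow> k = 0" "k = 0 \<longrightarrow> w = 0" "w = 0 \<longrightarrow> tail = []" "tail = [] \<or> hd tail"
proof -
  let ?a = "True # bs"
  define b where "b = dropWhile id ?a"
  define c where "c = dropWhile Not b"
  define d where "d = dropWhile id c"
  define e where "e = dropWhile Not d"
  have hb: "b = [] \<or> \<not> hd b" unfolding b_def using hd_dropWhile[of id ?a] by auto
  have hc: "c = [] \<or> hd c" unfolding c_def using hd_dropWhile[of Not b] by auto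
  have hd: "d = [] \<or> \<not> hd d" unfolding d_def using hd_dropWhile[of id c] by auto
  have he: "e = [] \<or> hd e" unfolding e_def using hd_dropWhile[of Not d] by auto
  show thesis
  proof (rule that[of "length (takeWhile id ?a)" "length (takeWhile Not b)" "length (takeWhile id c)"
        "length (takeWhile Not d)" e])
    show "?a = replicate (length (takeWhile id ?a)) True @ replicate (length (takeWhile Not b)) False @
      replicate (length (takeWhile id c)) True @ replicate (length (takeWhile Not d)) False @ e"
      unfolding takeWhile_runs[symmetric] by (simp only: b_def c_def d_def e_def takeWhile_dropWhile_id)
    show "1 \<le> length (takeWhile id ?a)" by simp
    show "length (takeWhile id ?a) = jump bs" by (simp add: jump_def)
    show "length (takeWhile Not b) = 0 \<longrightarrow> length (takeWhile id c) = 0"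
      using hb by (cases b) (auto simp: c_def)
    show "length (takeWhile id c) = 0 \<longrightarrow> length (takeWhile Not d) = 0"
      using hc by (cases c) (auto simp: d_def)
    show "length (takeWhile Not d) = 0 \<longrightarrow> e = []"
      using hd by (cases d) (auto simp: e_def)
    show "e = [] \<or> hd e" by (rule he)
  qed
qed

text \<open>
  Flips behind the second run of ones do not change the first three runs, and the other flips are
  those of run_potential_drift.
\<close>
lemma km_gen_run_value:
  "real (jump bs - 32) + km_gen run_value (replicate m False @ True # bs) \<le> 3 * tail_const"
proof -
  obtain R Z k w tail where eq: "True # bs = replicate R True @ replicate Z False @ replicate k True @ replicate w False @ tail"
    and R: "1 \<le> R" "R = jump bs" and Zkw: "Z = 0 \<longrightarrow> k = 0" "k = 0 \<longrightarrow> w = 0" "w = 0 \<longrightarrow> tail = []"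
    and tail: "tail = [] \<or> hd tail"
    by (rule run_decomposition[of bs])
  have Z: "k = 0" if "Z = 0" using Zkw that by simp
  have k: "w = 0" if "k = 0" using Zkw that by simp
  have w: "tail = []" if "w = 0" using Zkw that by simp
  define z where "z = replicate m False @ True # bs"
  have z: "z = replicate m False @ replicate R True @ replicate Z False @ replicate k True @ replicate w False @ tail"
    by (simp add: z_def eq)
  have v: "run_value z = run_potential R Z k"
    unfolding z using R Z k w by (intro run_value_runs) (auto simp: hd_append hd_replicate)
  let ?h = "\<lambda>s. if z ! s then run_value (km_flip s z) - run_value z else 0"
  have len: "length z = m + (R + (Z + (k + (w + length tail))))" by (simp add: z)
  have gen: "km_gen run_value z =
      (\<Sum>i<m. ?h i) + ((\<Sum>j<R. ?h (m + j)) + ((\<Sum>i<Z. ?h (m + (R + i))) +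
      ((\<Sum>j<k. ?h (m + (R + (Z + j)))) + ((\<Sum>i<w. ?h (m + (R + (Z + (k + i))))) +
       (\<Sum>i<length tail. ?h (m + (R + (Z + (k + (w + i))))))))))"
    unfolding km_gen_alt len sum_lessThan_add ..
  have nth: "\<not> z ! i" if "i < m" for i using that by (simp add: z nth_append)
  have nthZ: "\<not> z ! (m + (R + i))" if "i < Z" for i using that by (simp add: z nth_append)
  have nthw: "\<not> z ! (m + (R + (Z + (k + i))))" if "i < w" for i using that by (simp add: z nth_append)
  have nthR: "z ! (m + j)" if "j < R" for j using that by (simp add: z nth_append)
  have nthk: "z ! (m + (R + (Z + j)))" if "j < k" for j using that by (simp add: z nth_append)
  have lead: "run_value (km_flip m z) = run_potential Z k w"
  proof -
    have "km_flip m z = replicate (m + R) False @ replicate Z True @ replicate k False @ replicate w True @ map Not tail"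
      by (simp add: z km_flip_def replicate_add)
    then show ?thesis
      using Z k w tail by (simp only:) (intro run_value_runs, auto simp: hd_map)
  qed
  have innerR: "run_value (km_flip (m + j) z) = run_potential j (R - j) Z" if "1 \<le> j" "j < R" for j
  proof -
    have "replicate R True = replicate j True @ replicate (R - j) True"
      using that by (simp flip: replicate_add)
    then have "km_flip (m + j) z = replicate m False @ replicate j True @ replicate (R - j) False @ replicate Z True @
        (replicate k False @ replicate w True @ map Not tail)"
      unfolding z using that by (simp add: km_flip_def)
    then show ?thesis
      using Z k w tail that by (simp only:) (intro run_value_runs, auto simp: hd_append hd_map)
  qed
  have merge: "run_value (km_flip (m + (R + (Z + 0))) z) = run_potential R (Z + k) w" if "1 \<le> k"
  proof -
    have "km_flip (m + (R + (Z + 0))) z =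
        replicate m False @ replicate R True @ replicate (Z + k) False @ replicate w True @ map Not tail"
      by (simp add: z km_flip_def replicate_add)
    then show ?thesis
      using Z k w tail that R by (simp only:) (intro run_value_runs, auto simp: hd_map)
  qed
  have innerk: "run_value (km_flip (m + (R + (Z + j))) z) = run_potential R Z j" if "1 \<le> j" "j < k" for j
  proof -
    have "replicate k True = replicate j True @ replicate (k - j) True"
      using that by (simp flip: replicate_add)
    then have "km_flip (m + (R + (Z + j))) z = replicate m False @ replicate R True @ replicate Z False @ replicate j True @
        (replicate (k - j) False @ replicate w True @ map Not tail)"
      unfolding z using that by (simp add: km_flip_def)
    then show ?thesis
      using Z R that by (simp only:) (intro run_value_runs, auto simp: hd_append)
  qed
  have outer: "?h (m + (R + (Z + (k + (w + i))))) = 0" if "i < length tail" for i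
  proof -
    have "w \<noteq> 0" using w that by (metis length_0_conv less_nat_zero_code)
    then have "km_flip (m + (R + (Z + (k + (w + i))))) z = replicate m False @ replicate R True @ replicate Z False @
        replicate k True @ (replicate w False @ km_flip i tail)"
      by (simp add: z km_flip_def)
    then have "run_value (km_flip (m + (R + (Z + (k + (w + i))))) z) = run_potential R Z k"
      using R Z k \<open>w \<noteq> 0\<close> by (simp only:) (intro run_value_runs, auto simp: hd_append)
    then show ?thesis by (simp add: v)
  qed
  have sumR: "(\<Sum>j<R. ?h (m + j)) = run_potential Z k w - run_potential R Z k +
      (\<Sum>j=1..<R. run_potential j (R - j) Z - run_potential R Z k)"
  proof -
    have "(\<Sum>j<R. ?h (m + j)) = ?h (m + 0) + (\<Sum>j=1..<R. ?h (m + j))"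
      unfolding lessThan_atLeast0 using R(1) by (subst sum.atLeast_Suc_lessThan) auto
    also have "(\<Sum>j=1..<R. ?h (m + j)) = (\<Sum>j=1..<R. run_potential j (R - j) Z - run_potential R Z k)"
      by (intro sum.cong refl) (simp add: nthR innerR v)
    also have "?h (m + 0) = run_potential Z k w - run_potential R Z k"
      using nthR[of 0] R(1) lead by (simp add: v)
    finally show ?thesis .
  qed
  have sumk: "(\<Sum>j<k. ?h (m + (R + (Z + j)))) =
      (if 1 \<le> k then run_potential R (Z + k) w - run_potential R Z k else 0) +
      (\<Sum>j=1..<k. run_potential R Z j - run_potential R Z k)"
  proof (cases "k = 0")
    case False
    have "(\<Sum>j<k. ?h (m + (R + (Z + j)))) = ?h (m + (R + (Z + 0))) + (\<Sum>j=1..<k. ?h (m + (R + (Z + j))))"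
      unfolding lessThan_atLeast0 using False by (subst sum.atLeast_Suc_lessThan) auto
    also have "(\<Sum>j=1..<k. ?h (m + (R + (Z + j)))) = (\<Sum>j=1..<k. run_potential R Z j - run_potential R Z k)"
      by (intro sum.cong refl) (simp add: nthk innerk v)
    also have "?h (m + (R + (Z + 0))) = run_potential R (Z + k) w - run_potential R Z k"
      using nthk[of 0] False merge by (simp add: v)
    finally show ?thesis using False by simp
  qed simp
  have "km_gen run_value z = (\<Sum>j<R. ?h (m + j)) + (\<Sum>j<k. ?h (m + (R + (Z + j))))"
    unfolding gen using nth nthZ nthw outer by (simp add: sum.neutral)
  then show ?thesis
    using run_potential_drift[OF R(1), of Z k w, OF Z k] unfolding sumR sumk z_def[symmetric] R(2)[symmetric]
    by linarith
qed

text \<open>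
  The slope (10/9) / m is below 1/1000 from m = 1112 on. Any bound of the form constant plus a
  small multiple of Z suffices, since the final constants leave some room.
\<close>
lemma tail_log_le: "tail_log Z \<le> real (min Z 1112) + real Z / 1000"
proof (induction Z)
  case (Suc Z)
  have "tail_slope (Suc Z) \<le> (if Z < 1112 then 1 else 0) + 1 / 1000"
    by (auto simp: tail_slope_def divide_simps)
  moreover have "real (min (Suc Z) 1112) = real (min Z 1112) + (if Z < 1112 then 1 else 0)"
    by (auto simp: min_def)
  ultimately show ?case using Suc unfolding tail_log_Suc of_nat_Suc add_divide_distrib by linarith
qed simp

lemma run_value_ones: "1 \<le> R \<Longrightarrow> run_value (replicate m False @ replicate R True) = leading_part R"
  using run_value_runs[of R 0 0 "[]" m] by (simp add: run_potential_def)


section \<open>The two certificates\<close>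

text \<open>
  Relative values, times 5000 and rounded, of the decision problem in which the adversary
  minimizes the speed of the leading one. Longer contexts are used where they influence the speed
  most.
\<close>
definition upper_tree :: context_tree where
  "upper_tree =
   Branch (Branch (Branch (Branch (Branch (Branch (Branch (Branch (Branch (Branch (Branch (Leaf 0)
   (Leaf (- 302))) (Branch (Leaf (- 881)) (Leaf (- 689)))) (Branch (Branch (Leaf (- 1637)) (Leaf (-
   1701))) (Leaf (- 1366)))) (Branch (Branch (Leaf (- 2399)) (Leaf (- 2652))) (Branch (Leaf (- 2238))
   (Leaf (- 1930))))) (Branch (Branch (Branch (Leaf (- 3169)) (Leaf (- 3380))) (Branch (Leaf (- 3766))
   (Leaf (- 3577)))) (Branch (Branch (Leaf (- 3043)) (Leaf (- 3252))) (Branch (Leaf (- 2824)) (Leaf (-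
   2557)))))) (Branch (Branch (Branch (Branch (Leaf (- 4123)) (Leaf (- 4212))) (Branch (Leaf (- 4563))
   (Leaf (- 4434)))) (Branch (Branch (Leaf (- 4889)) (Leaf (- 5021))) (Leaf (- 4770)))) (Branch (Branch
   (Leaf (- 4160)) (Branch (Leaf (- 4446)) (Leaf (- 4324)))) (Branch (Branch (Leaf (- 3748)) (Leaf (-
   3918))) (Leaf (- 3517)))))) (Branch (Branch (Branch (Branch (Leaf (- 5137)) (Leaf (- 5449))) (Branch
   (Leaf (- 5933)) (Leaf (- 5693)))) (Branch (Branch (Leaf (- 6254)) (Leaf (- 6458))) (Branch (Leaf (-
   6150)) (Leaf (- 5895))))) (Branch (Branch (Branch (Leaf (- 5080)) (Leaf (- 5379))) (Branch (Branch
   (Leaf (- 5711)) (Leaf (- 5780))) (Leaf (- 5539)))) (Branch (Branch (Leaf (- 4903)) (Leaf (- 5174)))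
   (Branch (Leaf (- 4693)) (Leaf (- 4289))))))) (Branch (Branch (Branch (Branch (Branch (Leaf (- 6105))
   (Leaf (- 6411))) (Branch (Leaf (- 6872)) (Leaf (- 6642)))) (Branch (Branch (Leaf (- 7211)) (Leaf (-
   7408))) (Branch (Leaf (- 7124)) (Leaf (- 6890))))) (Branch (Branch (Branch (Leaf (- 7551)) (Leaf (-
   7756))) (Branch (Leaf (- 8049)) (Leaf (- 7877)))) (Branch (Branch (Leaf (- 7477)) (Leaf (- 7666)))
   (Branch (Leaf (- 7351)) (Leaf (- 7118)))))) (Branch (Branch (Branch (Branch (Leaf (- 6098)) (Leaf (-
   6379))) (Branch (Leaf (- 6799)) (Leaf (- 6581)))) (Branch (Branch (Leaf (- 7073)) (Leaf (- 7261)))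
   (Branch (Leaf (- 6968)) (Leaf (- 6733))))) (Branch (Branch (Branch (Leaf (- 5917)) (Leaf (- 6195)))
   (Branch (Leaf (- 6571)) (Leaf (- 6336)))) (Branch (Branch (Leaf (- 5712)) (Leaf (- 5968))) (Branch
   (Leaf (- 5500)) (Leaf (- 5114)))))))) (Branch (Branch (Branch (Branch (Branch (Branch (Leaf (-
   7139)) (Leaf (- 7429))) (Branch (Leaf (- 7874)) (Leaf (- 7658)))) (Branch (Branch (Leaf (- 8214))
   (Leaf (- 8402))) (Branch (Leaf (- 8132)) (Leaf (- 7913))))) (Branch (Branch (Branch (Leaf (- 8584))
   (Leaf (- 8774))) (Branch (Leaf (- 9050)) (Leaf (- 8891)))) (Branch (Branch (Leaf (- 8522)) (Leaf (-
   8697))) (Leaf (- 8407))))) (Branch (Branch (Branch (Branch (Leaf (- 9030)) (Leaf (- 9165))) (Branch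
   (Leaf (- 9442)) (Leaf (- 9297)))) (Branch (Branch (Leaf (- 9637)) (Leaf (- 9774))) (Leaf (- 9566))))
   (Branch (Branch (Leaf (- 9121)) (Branch (Leaf (- 9341)) (Leaf (- 9214)))) (Branch (Leaf (- 8985))
   (Leaf (- 8664)))))) (Branch (Branch (Branch (Branch (Branch (Leaf (- 7255)) (Leaf (- 7471))) (Leaf (- 7864))) (Branch (Branch (Leaf (- 8208)) (Leaf (- 8343))) (Leaf (- 8074)))) (Branch (Branch (Leaf (- 8674)) (Branch (Leaf (- 8900)) (Leaf (- 8781)))) (Branch (Leaf (- 8561)) (Leaf (- 8249)))))
   (Branch (Branch (Branch (Leaf (- 7321)) (Leaf (- 7656))) (Branch (Branch (Leaf (- 7937)) (Leaf (-
   8075))) (Leaf (- 7800)))) (Branch (Branch (Leaf (- 7074)) (Branch (Leaf (- 7388)) (Leaf (- 7207))))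
   (Branch (Leaf (- 6836)) (Branch (Leaf (- 6349)) (Leaf (- 6086))))))))) (Branch (Branch (Branch
   (Branch (Branch (Branch (Branch (Leaf (- 8157)) (Leaf (- 8403))) (Branch (Leaf (- 8836)) (Leaf (-
   8698)))) (Branch (Branch (Leaf (- 9203)) (Leaf (- 9354))) (Leaf (- 9098)))) (Branch (Branch (Leaf (-
   9791)) (Branch (Leaf (- 10007)) (Leaf (- 9905)))) (Branch (Leaf (- 9700)) (Leaf (- 9410))))) (Branch
   (Branch (Branch (Leaf (- 10217)) (Leaf (- 10456))) (Branch (Branch (Leaf (- 10681)) (Leaf (-
   10764))) (Leaf (- 10583)))) (Branch (Branch (Leaf (- 10142)) (Leaf (- 10347))) (Branch (Leaf (-
   10014)) (Leaf (- 9720)))))) (Branch (Branch (Branch (Branch (Leaf (- 10625)) (Leaf (- 10868)))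
   (Branch (Branch (Leaf (- 11138)) (Leaf (- 11203))) (Leaf (- 11020)))) (Branch (Branch (Leaf (-
   11441)) (Branch (Leaf (- 11603)) (Leaf (- 11529)))) (Branch (Leaf (- 11361)) (Leaf (- 11152)))))
   (Branch (Branch (Branch (Leaf (- 10554)) (Leaf (- 10778))) (Branch (Leaf (- 11087)) (Leaf (-
   10889)))) (Branch (Branch (Leaf (- 10414)) (Leaf (- 10617))) (Branch (Leaf (- 10260)) (Leaf (-
   9965))))))) (Branch (Branch (Branch (Branch (Branch (Leaf (- 8511)) (Leaf (- 8840))) (Branch (Leaf (- 9334)) (Leaf (- 9069)))) (Branch (Branch (Leaf (- 9680)) (Leaf (- 9899))) (Branch (Leaf (- 9578))
   (Leaf (- 9300))))) (Branch (Branch (Branch (Leaf (- 10005)) (Leaf (- 10237))) (Branch (Branch (Leaf (- 10468)) (Leaf (- 10544))) (Leaf (- 10350)))) (Branch (Branch (Leaf (- 9899)) (Leaf (- 10112)))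
   (Branch (Leaf (- 9760)) (Leaf (- 9474)))))) (Branch (Branch (Branch (Branch (Leaf (- 8272)) (Leaf (-
   8605))) (Branch (Leaf (- 9067)) (Leaf (- 8798)))) (Branch (Branch (Leaf (- 9356)) (Leaf (- 9578)))
   (Branch (Leaf (- 9241)) (Leaf (- 8949))))) (Branch (Branch (Branch (Leaf (- 7997)) (Leaf (- 8329)))
   (Branch (Leaf (- 8754)) (Leaf (- 8472)))) (Branch (Branch (Leaf (- 7728)) (Leaf (- 8037))) (Branch
   (Leaf (- 7471)) (Leaf (- 6996))))))))) (Branch (Branch (Branch (Branch (Branch (Branch (Branch
   (Branch (Branch (Branch (Leaf (- 1300)) (Leaf (- 1586))) (Leaf (- 2055))) (Branch (Branch (Leaf (-
   2495)) (Leaf (- 2601))) (Leaf (- 2340)))) (Branch (Branch (Leaf (- 3182)) (Leaf (- 3380))) (Leaf (-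
   3101)))) (Branch (Branch (Leaf (- 4121)) (Leaf (- 4350))) (Branch (Leaf (- 3907)) (Leaf (- 3588)))))
   (Branch (Branch (Branch (Leaf (- 4785)) (Leaf (- 5017))) (Branch (Leaf (- 5437)) (Leaf (- 5245))))
   (Branch (Branch (Leaf (- 4678)) (Leaf (- 4882))) (Leaf (- 4419))))) (Branch (Branch (Branch (Branch
   (Leaf (- 5602)) (Leaf (- 5750))) (Branch (Leaf (- 6161)) (Leaf (- 5996)))) (Branch (Branch (Leaf (-
   6505)) (Leaf (- 6651))) (Leaf (- 6355)))) (Branch (Branch (Leaf (- 5691)) (Branch (Leaf (- 6024))
   (Leaf (- 5882)))) (Branch (Leaf (- 5479)) (Leaf (- 5000)))))) (Branch (Branch (Branch (Branch (Leaf (- 6567)) (Leaf (- 6939))) (Branch (Branch (Leaf (- 7336)) (Leaf (- 7435))) (Leaf (- 7166))))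
   (Branch (Branch (Leaf (- 7777)) (Branch (Leaf (- 8019)) (Leaf (- 7912)))) (Branch (Leaf (- 7671))
   (Leaf (- 7361))))) (Branch (Branch (Branch (Leaf (- 6477)) (Leaf (- 6825))) (Branch (Leaf (- 7286))
   (Leaf (- 6984)))) (Branch (Branch (Leaf (- 6277)) (Leaf (- 6594))) (Branch (Leaf (- 6041)) (Leaf (-
   5579))))))) (Branch (Branch (Branch (Branch (Branch (Leaf (- 7271)) (Leaf (- 7640))) (Branch (Leaf (- 8165)) (Leaf (- 7885)))) (Branch (Branch (Leaf (- 8526)) (Leaf (- 8768))) (Branch (Leaf (- 8429))
   (Leaf (- 8137))))) (Branch (Branch (Branch (Leaf (- 8875)) (Leaf (- 9131))) (Branch (Branch (Leaf (-
   9387)) (Leaf (- 9457))) (Leaf (- 9252)))) (Branch (Branch (Leaf (- 8781)) (Leaf (- 9006))) (Branch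
   (Leaf (- 8637)) (Leaf (- 8335)))))) (Branch (Branch (Branch (Branch (Leaf (- 7169)) (Leaf (- 7521)))
   (Branch (Leaf (- 8006)) (Leaf (- 7727)))) (Branch (Branch (Leaf (- 8298)) (Leaf (- 8530))) (Branch
   (Leaf (- 8180)) (Leaf (- 7875))))) (Branch (Branch (Branch (Leaf (- 6929)) (Leaf (- 7269))) (Branch
   (Leaf (- 7716)) (Leaf (- 7417)))) (Branch (Branch (Leaf (- 6675)) (Leaf (- 6994))) (Branch (Leaf (-
   6413)) (Leaf (- 5932)))))))) (Branch (Branch (Branch (Branch (Branch (Branch (Branch (Branch (Leaf (- 1534)) (Leaf (- 1852))) (Leaf (- 2350))) (Branch (Leaf (- 3116)) (Leaf (- 2834)))) (Branch
   (Branch (Leaf (- 3734)) (Leaf (- 3972))) (Leaf (- 3531)))) (Branch (Branch (Leaf (- 4629)) (Branch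
   (Leaf (- 4993)) (Leaf (- 4835)))) (Branch (Leaf (- 4479)) (Leaf (- 3989))))) (Branch (Branch (Branch
   (Leaf (- 5265)) (Leaf (- 5650))) (Branch (Branch (Leaf (- 6007)) (Leaf (- 6128))) (Leaf (- 5833))))
   (Branch (Branch (Leaf (- 5137)) (Leaf (- 5473))) (Branch (Leaf (- 4918)) (Leaf (- 4426)))))) (Branch
   (Branch (Branch (Branch (Leaf (- 5853)) (Leaf (- 6241))) (Branch (Leaf (- 6767)) (Leaf (- 6465))))
   (Branch (Branch (Leaf (- 7087)) (Leaf (- 7342))) (Branch (Leaf (- 6967)) (Leaf (- 6636))))) (Branch
   (Branch (Branch (Leaf (- 5695)) (Leaf (- 6066))) (Branch (Leaf (- 6538)) (Leaf (- 6219)))) (Branch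
   (Branch (Leaf (- 5454)) (Leaf (- 5797))) (Branch (Leaf (- 5204)) (Leaf (- 4689))))))) (Branch
   (Branch (Branch (Branch (Branch (Branch (Leaf (- 1412)) (Leaf (- 1809))) (Branch (Leaf (- 2530))
   (Leaf (- 2247)))) (Branch (Branch (Leaf (- 3149)) (Leaf (- 3369))) (Leaf (- 2911)))) (Branch (Branch
   (Leaf (- 3969)) (Branch (Leaf (- 4352)) (Leaf (- 4195)))) (Branch (Leaf (- 3804)) (Leaf (- 3288)))))
   (Branch (Branch (Branch (Leaf (- 4490)) (Leaf (- 4896))) (Branch (Branch (Leaf (- 5257)) (Leaf (-
   5393))) (Leaf (- 5067)))) (Branch (Branch (Leaf (- 4311)) (Leaf (- 4670))) (Branch (Leaf (- 4061))
   (Leaf (- 3524)))))) (Branch (Branch (Branch (Branch (Branch (Leaf (- 821)) (Leaf (- 1181))) (Branch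
   (Leaf (- 1898)) (Leaf (- 1634)))) (Branch (Branch (Leaf (- 2494)) (Leaf (- 2718))) (Leaf (- 2239))))
   (Branch (Branch (Leaf (- 3236)) (Branch (Leaf (- 3632)) (Leaf (- 3423)))) (Branch (Branch (Leaf (-
   2775)) (Leaf (- 2994))) (Leaf (- 2456))))) (Branch (Branch (Branch (Branch (Leaf (- 216)) (Leaf (-
   551))) (Branch (Leaf (- 1264)) (Leaf (- 953)))) (Branch (Branch (Leaf (- 1743)) (Leaf (- 2035)))
   (Branch (Leaf (- 1501)) (Leaf (- 1175))))) (Branch (Branch (Branch (Leaf 451) (Leaf 53)) (Branch
   (Leaf (- 624)) (Leaf (- 200)))) (Branch (Branch (Leaf 1138) (Leaf 649)) (Branch (Branch (Leaf 2046)
   (Leaf 1772)) (Branch (Leaf 2629) (Leaf 3233))))))))))"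

text \<open>
  Relative values, times -1000 and rounded, of the decision problem in which the adversary
  maximizes the average of min R 32. The sign makes it a minimization, as for the other tree. The
  context of 31 ones is a leaf, so that the truncated drift is always known.
\<close>
definition lower_tree :: context_tree where
  "lower_tree =
   Branch (Branch (Branch (Branch (Branch (Branch (Branch (Branch (Branch (Branch (Branch (Branch
   (Branch (Branch (Branch (Branch (Branch (Branch (Branch (Branch (Branch (Branch (Branch (Branch
   (Branch (Branch (Branch (Branch (Branch (Leaf 583) (Leaf 650)) (Leaf 668)) (Leaf 687)) (Leaf 707))
   (Leaf 728)) (Branch (Leaf 822) (Leaf 774))) (Branch (Leaf 870) (Leaf 807))) (Branch (Leaf 911) (Leaf
   836))) (Branch (Leaf 951) (Leaf 866))) (Branch (Leaf 992) (Leaf 898))) (Branch (Leaf 1035) (Leaf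
   931))) (Branch (Leaf 1081) (Leaf 966))) (Branch (Leaf 1130) (Leaf 1003))) (Branch (Leaf 1186) (Leaf
   1046))) (Branch (Leaf 1298) (Leaf 1109))) (Branch (Leaf 1380) (Branch (Leaf 1319) (Leaf 1203))))
   (Branch (Leaf 1479) (Branch (Leaf 1402) (Leaf 1271)))) (Branch (Leaf 1600) (Branch (Leaf 1527) (Leaf
   1372)))) (Branch (Leaf 1725) (Branch (Leaf 1635) (Leaf 1463)))) (Branch (Leaf 1911) (Branch (Leaf
   1898) (Leaf 1638)))) (Branch (Leaf 2129) (Branch (Leaf 2086) (Leaf 1796)))) (Branch (Leaf 2419)
   (Branch (Leaf 2339) (Branch (Leaf 2201) (Leaf 2025))))) (Branch (Branch (Leaf 2683) (Leaf 2971))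
   (Branch (Leaf 2668) (Branch (Leaf 2430) (Leaf 2219))))) (Branch (Branch (Branch (Leaf 2918) (Leaf
   3220)) (Branch (Leaf 3504) (Leaf 3312))) (Branch (Leaf 2979) (Branch (Leaf 2847) (Branch (Leaf 2735)
   (Leaf 2484)))))) (Branch (Branch (Branch (Branch (Leaf 3184) (Leaf 3444)) (Leaf 3526)) (Branch (Leaf
   3873) (Leaf 3628))) (Branch (Branch (Leaf 3235) (Leaf 3538)) (Branch (Leaf 3216) (Branch (Leaf 3052)
   (Leaf 2702)))))) (Branch (Branch (Branch (Branch (Branch (Leaf 3434) (Leaf 3683)) (Leaf 3773))
   (Branch (Leaf 4121) (Leaf 3907))) (Branch (Leaf 4245) (Leaf 3923))) (Branch (Branch (Leaf 3507)
   (Leaf 3844)) (Branch (Leaf 3495) (Branch (Leaf 3340) (Branch (Leaf 3258) (Leaf 2941))))))) (Branch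
   (Branch (Branch (Branch (Branch (Branch (Leaf 3685) (Leaf 3921)) (Leaf 3976)) (Leaf 4097)) (Branch
   (Leaf 4471) (Leaf 4195))) (Branch (Leaf 4559) (Branch (Leaf 4519) (Leaf 4256)))) (Branch (Branch
   (Branch (Leaf 3763) (Leaf 4120)) (Branch (Leaf 4406) (Leaf 4167))) (Branch (Branch (Leaf 3756) (Leaf
   4064)) (Branch (Leaf 3718) (Branch (Leaf 3529) (Branch (Leaf 3463) (Leaf 3162)))))))) (Branch
   (Branch (Branch (Branch (Branch (Branch (Branch (Leaf 3908) (Leaf 4126)) (Leaf 4187)) (Branch (Leaf
   4468) (Leaf 4349))) (Branch (Leaf 4695) (Leaf 4426))) (Branch (Leaf 4795) (Leaf 4459))) (Branch
   (Branch (Leaf 4870) (Leaf 5116)) (Branch (Leaf 4891) (Leaf 4526)))) (Branch (Branch (Branch (Leaf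
   4000) (Leaf 4383)) (Branch (Leaf 4762) (Leaf 4424))) (Branch (Branch (Leaf 3974) (Leaf 4304))
   (Branch (Branch (Leaf 3933) (Leaf 4131)) (Branch (Leaf 3754) (Branch (Leaf 3637) (Branch (Leaf 3577)
   (Branch (Leaf 3510) (Leaf 3283)))))))))) (Branch (Branch (Branch (Branch (Branch (Branch (Branch
   (Branch (Branch (Branch (Branch (Branch (Branch (Branch (Branch (Branch (Branch (Branch (Branch
   (Branch (Branch (Leaf 1433) (Leaf 1594)) (Leaf 1611)) (Leaf 1630)) (Leaf 1649)) (Leaf 1670)) (Leaf
   1695)) (Leaf 1721)) (Leaf 1749)) (Leaf 1779)) (Branch (Leaf 1997) (Leaf 1873))) (Branch (Leaf 2078)
   (Leaf 1926))) (Branch (Leaf 2189) (Leaf 2016))) (Branch (Leaf 2382) (Leaf 2177))) (Branch (Leaf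
   2599) (Leaf 2298))) (Branch (Leaf 2759) (Leaf 2390))) (Branch (Leaf 2921) (Branch (Leaf 2893) (Leaf
   2568)))) (Branch (Leaf 3195) (Branch (Leaf 3094) (Leaf 2719)))) (Branch (Leaf 3396) (Branch (Leaf
   3263) (Leaf 2808)))) (Branch (Branch (Leaf 3554) (Leaf 3949)) (Branch (Leaf 3595) (Branch (Leaf
   3379) (Leaf 2961))))) (Branch (Branch (Branch (Leaf 3713) (Leaf 4142)) (Branch (Leaf 4526) (Leaf
   4188))) (Branch (Branch (Leaf 3747) (Leaf 4104)) (Branch (Leaf 3740) (Branch (Leaf 3531) (Branch
   (Leaf 3452) (Leaf 3060))))))) (Branch (Branch (Branch (Branch (Branch (Branch (Branch (Branch
   (Branch (Leaf 1602) (Leaf 2052)) (Leaf 2102)) (Leaf 2214)) (Leaf 2356)) (Branch (Leaf 2872) (Leaf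
   2533))) (Branch (Leaf 3126) (Leaf 2639))) (Branch (Leaf 3335) (Branch (Leaf 3213) (Leaf 2744))))
   (Branch (Branch (Leaf 3460) (Leaf 3831)) (Branch (Branch (Leaf 3468) (Leaf 3682)) (Branch (Leaf
   3299) (Branch (Leaf 3192) (Leaf 2797)))))) (Branch (Branch (Branch (Branch (Branch (Branch (Leaf
   1570) (Leaf 2085)) (Leaf 2201)) (Branch (Leaf 2708) (Leaf 2404))) (Branch (Leaf 2991) (Leaf 2489)))
   (Branch (Branch (Leaf 3169) (Leaf 3410)) (Branch (Leaf 3044) (Branch (Leaf 2930) (Leaf 2514)))))
   (Branch (Branch (Branch (Branch (Branch (Leaf 1470) (Leaf 1921)) (Leaf 2023)) (Branch (Leaf 2585)
   (Leaf 2231))) (Branch (Branch (Leaf 2776) (Leaf 2950)) (Branch (Leaf 2704) (Leaf 2248)))) (Branch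
   (Branch (Branch (Leaf 1360) (Leaf 1867)) (Branch (Leaf 2442) (Leaf 1970))) (Branch (Branch (Branch
   (Leaf 1215) (Leaf 1590)) (Leaf 1672)) (Branch (Branch (Branch (Leaf 1015) (Leaf 1296)) (Leaf 1252))
   (Branch (Branch (Branch (Leaf 789) (Leaf 1040)) (Leaf 989)) (Branch (Branch (Leaf 540) (Leaf 708))
   (Branch (Branch (Leaf 408) (Leaf 559)) (Branch (Branch (Leaf 250) (Leaf 385)) (Branch (Branch (Leaf
   160) (Leaf 282)) (Branch (Branch (Leaf 76) (Leaf 179)) (Branch (Leaf 0) (Branch (Leaf (- 75))
   (Branch (Leaf (- 137)) (Branch (Leaf (- 196)) (Branch (Leaf (- 252)) (Branch (Leaf (- 305)) (Branch
   (Leaf (- 355)) (Branch (Leaf (- 402)) (Branch (Leaf (- 454)) (Branch (Leaf (- 497)) (Branch (Leaf (-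
   539)) (Branch (Leaf (- 578)) (Branch (Leaf (- 616)) (Branch (Leaf (- 652)) (Branch (Leaf (- 687))
   (Branch (Leaf (- 723)) (Branch (Leaf (- 755)) (Leaf (- 787))))))))))))))))))))))))))))))))"

text \<open>
  The speed is at least 8227/5000, which exceeds 1 / (4 * 0.152) = 1.6447... .
\<close>
lemma upper_tree_check: "every_context (\<lambda>p. 8227 \<le> context_gain 5000 upper_tree p) upper_tree"
  by code_simp

text \<open>
  The truncated speed is at most 2.384. Together with the tail this gives 2.9, below 1 / (4 *
  0.086) = 2.906... .
\<close>
lemma lower_tree_check:
  "every_context (\<lambda>p. - 2384 \<le> context_gain (- 1000) lower_tree p \<and> (list_ex Not p \<or> 32 \<le> jump p)) lower_tree"
  by code_simp

lemma tree_depths: "depth upper_tree = 11" "depth lower_tree = 31"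
  by code_simp+


section \<open>The quadratic bounds\<close>

lemma suffix_ones_padding:
  assumes "i < n"
  shows "take n (suffix_ones n i @ replicate d True) = suffix_ones n i"
    and "length (suffix_ones n i @ replicate d True) = n + d"
    and "lead (suffix_ones n i @ replicate d True) = n - 1 - i"
    and "suffix_ones n i @ replicate d True = replicate (n - 1 - i) False @ replicate (Suc i + d) True"
proof -
  have len: "length (suffix_ones n i) = n" using assms by (simp add: suffix_ones_def)
  then show "take n (suffix_ones n i @ replicate d True) = suffix_ones n i"
    "length (suffix_ones n i @ replicate d True) = n + d" by simp_all
  show eq: "suffix_ones n i @ replicate d True = replicate (n - 1 - i) False @ replicate (Suc i + d) True"
    using assms by (simp add: suffix_ones_def replicate_add)
  show "lead (suffix_ones n i @ replicate d True) = n - 1 - i"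
    unfolding eq by (simp add: lead_replicate_True)
qed

text \<open>
  The comparison function is the distance of the leading one to n, corrected by the tree value and
  divided by the certified speed; the tree value is bounded and contributes a constant.
\<close>
lemma potential_le_certificate:
  assumes check: "every_context (\<lambda>p. \<gamma> \<le> context_gain S t p) t" and S: "0 \<le> S" and \<gamma>: "0 < \<gamma>"
  shows "\<exists>C. \<forall>n K i. i < n \<longrightarrow>
    potential n K (suffix_ones n i) \<le> real_of_int S / real_of_int \<gamma> * (real i + 1) + C"
proof -
  obtain M where M: "\<And>bs. \<bar>least_value t bs\<bar> \<le> M" using least_value_bounded by blast
  define d where "d = depth t"
  define c where "c = real_of_int S * real d + real_of_int M"
  let ?f = "\<lambda>z. real_of_int S * real (lead z) + real_of_int (context_value t z)"
  have X: "real_of_int (context_value t z) \<le> real_of_int M" "- real_of_int M \<le> real_of_int (context_value t z)" for z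
    using M[of "window z"] unfolding context_value_def of_int_minus[symmetric] of_int_le_iff by auto
  have "potential n K (suffix_ones n i) \<le> real_of_int S / real_of_int \<gamma> * (real i + 1) + (c + real_of_int M) / real_of_int \<gamma>"
    if i: "i < n" for n K i
  proof -
    \<comment> \<open>The constant c keeps the function nonnegative on the target, where the leading one may
       still be up to d positions beyond n.\<close>
    define \<Phi> where "\<Phi> z = - (1 / real_of_int \<gamma>) * (?f z + (- real_of_int S * real n - c))" for z
    let ?z = "suffix_ones n i @ replicate d True"
    have "potential n K (take n ?z) \<le> \<Phi> ?z"
    proof (rule potential_le)
      fix z assume z: "length z = n + d" "lead z < n"
      then have "lead z < length z" by simp
      note dec = lead_decomposition[OF this] and len = length_window[OF this]
      define bs where "bs = window z"
      have h: "depth t \<le> length bs" using len z by (simp add: bs_def d_def)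
      obtain r where r: "bs = context_of t bs @ r" using context_of_prefix by blast
      have "jump (context_of t bs) \<le> jump bs" using jump_context_le[of "context_of t bs" r] r by simp
      then have "0 \<le> real_of_int S * (real (jump bs) - real (jump (context_of t bs)))"
        using S by (intro mult_nonneg_nonneg) auto
      moreover have "real_of_int \<gamma> \<le> real_of_int (context_gain S t (context_of t bs))"
        using every_contextD[OF check h] by simp
      ultimately have "real_of_int \<gamma> \<le> km_gen ?f z"
        using context_gain_drift[OF h, of S "lead z"] dec unfolding bs_def by simp
      then show "km_gen \<Phi> z \<le> -1"
        unfolding \<Phi>_def km_gen_affine using \<gamma> by (simp add: field_simps)
    next
      fix z assume z: "length z = n + d" "n \<le> lead z"
      have "real (lead z) \<le> real n + real d" using lead_le[of z] z by linarith
      then have "real_of_int S * real (lead z) \<le> real_of_int S * (real n + real d)"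
        using S by (intro mult_left_mono) auto
      then have "?f z + (- real_of_int S * real n - c) \<le> 0"
        using X(1)[of z] by (simp add: c_def algebra_simps)
      then show "0 \<le> \<Phi> z" using \<gamma> by (simp add: \<Phi>_def divide_le_0_iff)
    qed (rule suffix_ones_padding(2)[OF i])
    also have "\<Phi> ?z = (real_of_int S * (real i + 1) - real_of_int (context_value t ?z) + c) / real_of_int \<gamma>"
    proof -
      have "real (n - 1 - i) = real n - 1 - real i" using i by linarith
      then show ?thesis unfolding \<Phi>_def suffix_ones_padding(3)[OF i] using \<gamma> by (simp add: field_simps)
    qed
    also have "\<dots> \<le> (real_of_int S * (real i + 1) + real_of_int M + c) / real_of_int \<gamma>"
      using X(2)[of ?z] \<gamma> by (intro divide_right_mono) auto
    finally show ?thesis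
      unfolding suffix_ones_padding(1)[OF i] by (simp add: add_divide_distrib algebra_simps)
  qed
  then show ?thesis by blast
qed

text \<open>
  The comparison function is the distance of the leading one to n, corrected by the tree value and
  by the tail potential, and divided by 29/10 = 2.384 + 0.516. At a string of trailing ones the
  tail potential is a leading part, so it is absorbed into a constant and a thousandth of the
  linear term.
\<close>
lemma potential_ge_certificate:
  "\<exists>C. \<forall>n K i. i < n \<longrightarrow> 2 * survival n K \<le> 1 \<longrightarrow>
    (1 - 2 * survival n K) * (999 / 2900 * (real i + 1) - C) \<le> potential n K (suffix_ones n i)"
proof -
  let ?t = lower_tree
  obtain M where M: "\<And>bs. \<bar>least_value ?t bs\<bar> \<le> M" using least_value_bounded by blast
  define c where "c = real_of_int M / 1000"
  let ?X = "\<lambda>z. real_of_int (- 1000) * real (lead z) + real_of_int (context_value ?t z)"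
  let ?f = "\<lambda>z. (1 / 1000) * ?X z - run_value z"
  have X: "real_of_int (context_value ?t z) / 1000 \<le> c" "- c \<le> real_of_int (context_value ?t z) / 1000" for z
  proof -
    have "real_of_int (context_value ?t z) \<le> real_of_int M" "real_of_int (- M) \<le> real_of_int (context_value ?t z)"
      using M[of "window z"] unfolding context_value_def of_int_le_iff by auto
    then show "real_of_int (context_value ?t z) / 1000 \<le> c" "- c \<le> real_of_int (context_value ?t z) / 1000"
      by (simp_all add: c_def)
  qed
  define C where "C = 1000 + 1000 * (c + c + tail_const)"
  have "(1 - 2 * survival n K) * (999 / 2900 * (real i + 1) - C) \<le> potential n K (suffix_ones n i)"
    if i: "i < n" and K: "2 * survival n K \<le> 1" for n K i
  proof -
    define \<Phi> where "\<Phi> z = (10 / 29) * (?f z + (real n - c))" for z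
    \<comment> \<open>Padding with ones, as many as the depth of the tree, prolongs the last run, so that the
       string has a single run of ones.\<close>
    let ?z = "suffix_ones n i @ replicate 31 True"
    have "999 / 2900 * (real i + 1) - C \<le> \<Phi> ?z"
    proof -
      have "run_value ?z = leading_part (Suc i + 31)"
        unfolding suffix_ones_padding(4)[OF i] by (rule run_value_ones) simp
      also have "\<dots> \<le> real (min (Suc i + 31) 1112) + real (Suc i + 31) / 1000 + tail_const"
        using leading_part_le[of "Suc i + 31"] tail_log_le[of "Suc i + 31"] by linarith
      also have "\<dots> \<le> 1113 + (real i + 1) / 1000 + tail_const"
      proof -
        have "real (min (Suc i + 31) 1112) \<le> 1112" by linarith
        then show ?thesis unfolding of_nat_add of_nat_Suc add_divide_distrib by linarith
      qed
      finally have "run_value ?z \<le> 1113 + (real i + 1) / 1000 + tail_const" .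
      moreover have "real (lead ?z) = real n - 1 - real i" 
        unfolding suffix_ones_padding(3)[OF i] using i by linarith
      ultimately have f: "999 / 1000 * (real i + 1) - 1113 - tail_const - c - c \<le> ?f ?z + (real n - c)"
        using X(2)[of ?z] unfolding of_int_minus of_int_numeral by argo
      have "0 \<le> c" using X[of "[]"] by linarith
      then have "999 / 2900 * (real i + 1) - C \<le> 10 / 29 * (999 / 1000 * (real i + 1) - 1113 - tail_const - c - c)"
        using tail_const_nonneg by (simp add: C_def field_simps)
      also have "\<dots> \<le> \<Phi> ?z"
        unfolding \<Phi>_def by (intro mult_left_mono f) simp
      finally show ?thesis .
    qed
    then have "(1 - 2 * survival n K) * (999 / 2900 * (real i + 1) - C) \<le> (1 - 2 * survival n K) * \<Phi> ?z"
      using K by (intro mult_left_mono) auto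
    also have "\<dots> \<le> potential n K (take n ?z)"
    proof (rule potential_ge)
      fix z assume z: "length z = n + 31" "lead z < n"
      then have "lead z < length z" by simp
      note dec = lead_decomposition[OF this] and len = length_window[OF this]
      define bs where "bs = window z"
      have h: "depth ?t \<le> length bs" using len z tree_depths by (simp add: bs_def)
      define p where "p = context_of ?t bs"
      obtain r where r: "bs = p @ r" using context_of_prefix unfolding p_def by blast
      have z': "replicate (lead z) False @ True # bs = z" using dec by (simp add: bs_def)
      have P: "- 2384 \<le> context_gain (- 1000) ?t p" "list_ex Not p \<or> 32 \<le> jump p"
        using every_contextD[OF lower_tree_check h] by (auto simp: p_def)
      have "real_of_int (- 2384) \<le> real_of_int (context_gain (- 1000) ?t p)"
        using P(1) by (simp only: of_int_le_iff)
      then have "- 2384 - 1000 * (real (jump bs) - real (jump p)) \<le> km_gen ?X z"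
        using context_gain_drift[OF h, of "- 1000" "lead z"] unfolding z' p_def by simp
      moreover have "real (jump bs - 32) + km_gen run_value z \<le> 516 / 1000"
        using km_gen_run_value[of bs "lead z"] tail_const_le unfolding z' by linarith
      moreover have "real (jump bs) \<le> real (jump p) + real (jump bs - 32)"
        using jump_context_truncated[OF P(2), of r] r by simp
      moreover have "- (29 / 10) \<le> 1 / 1000 * g - h"
        if "- 2384 - 1000 * (a - b) \<le> g" "t + h \<le> 516 / 1000" "a \<le> b + t" for a b g h t :: real
        using that by (simp add: field_simps)
      ultimately have "- (29 / 10) \<le> km_gen ?f z"
        unfolding km_gen_diff km_gen_cmult by blast
      then show "-1 \<le> km_gen \<Phi> z" unfolding \<Phi>_def km_gen_affine by simp
    next
      fix z assume z: "length z = n + 31" "n \<le> lead z"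
      then have "real n \<le> real (lead z)" by simp
      then have "?f z + (real n - c) \<le> 0" using X(1)[of z] run_value_nonneg[of z] by (simp add: diff_divide_distrib)
      then show "\<Phi> z \<le> 0" unfolding \<Phi>_def by (intro mult_nonneg_nonpos) (simp, assumption)
    qed (rule suffix_ones_padding(2)[OF i] K)+
    finally show ?thesis unfolding suffix_ones_padding(1)[OF i] .
  qed
  then show ?thesis by blast
qed

lemma sum_linear: "(\<Sum>i<n. a * (real i + 1) + c) = a * (real n * (real n + 1) / 2) + c * real n"
  by (induction n) (auto simp: field_simps)

theorem corollary3:
  shows "\<forall>\<^sub>F n in sequentially.
    ennreal (0.086 * (real n)^2) \<le> km_expected_steps n \<and>
    km_expected_steps n \<le> ennreal (0.152 * (real n)^2)"
proof -
  obtain C where C: "\<And>n K i. i < n \<Longrightarrow> potential n K (suffix_ones n i) \<le> 5000 / 8227 * (real i + 1) + C"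
    using potential_le_certificate[OF upper_tree_check] by auto
  obtain D where D: "\<And>n K i. i < n \<Longrightarrow> 2 * survival n K \<le> 1 \<Longrightarrow>
    (1 - 2 * survival n K) * (999 / 2900 * (real i + 1) - D) \<le> potential n K (suffix_ones n i)"
    using potential_ge_certificate by blast
  have "km_expected_steps n \<le> ennreal ((\<Sum>i<n. 5000 / 8227 * (real i + 1) + C) / 2)" for n
    by (rule km_expected_steps_le) (rule C)
  then have upper: "km_expected_steps n \<le> ennreal ((5000 / 8227 * (real n * (real n + 1) / 2) + C * real n) / 2)" for n
    unfolding sum_linear .
  have "ennreal ((\<Sum>i<n. 999 / 2900 * (real i + 1) + - D) / 2) \<le> km_expected_steps n" for n
  proof (rule km_expected_steps_ge)
    show "km_expected_steps n \<noteq> \<infinity>" using upper[of n] by (auto simp: top_unique)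
  qed (use D in auto)
  then have lower: "ennreal ((999 / 2900 * (real n * (real n + 1) / 2) + - D * real n) / 2) \<le> km_expected_steps n" for n
    unfolding sum_linear .
  have "eventually (\<lambda>n. (5000 / 8227 * (real n * (real n + 1) / 2) + C * real n) / 2 \<le> 0.152 * (real n)^2) sequentially"
    by real_asymp
  moreover have "eventually (\<lambda>n. 0.086 * (real n)^2 \<le> (999 / 2900 * (real n * (real n + 1) / 2) + - D * real n) / 2) sequentially"
    by real_asymp
  ultimately show ?thesis
    by eventually_elim (meson ennreal_leI lower upper order_trans)
qed

end
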